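(* Let $f,-g,h_1,\ldots,h_m:\mathbb{R}^n\to\mathbb{R}$ be convex polynomials of degree at most $2d$, and let $K:=\{x\in\mathbb{R}^n\mid h_i(x)\le 0,\ i=1,\ldots,m\}$. Assume that $K$ is nonempty and bounded, and that $f(x)\ge 0$ and $g(x)>0$ for every $x\in K$. Let $L$ and $C$ be real numbers with $L>\max_{x\in K}\|x\|$ and $C>2/\min_{x\in K}g(x)$. If the Slater condition holds, i.e., there exists $\hat{x}\in\mathbb{R}^n$ with $h_i(\hat{x})<0$ for all $i=1,\ldots,m$, then for every integer $r\ge d$, $$\max\,(\mathrm{D}_r)=\inf\,(\mathrm{Q}_r),$$ where $\max$ means that the supremum in (D$_r$) is attained. Furthermore, suppose that $\bar{y}$ is an optimal solution to (Q$_r$) with $\bar{y}_0\neq 0$. If $\operatorname{rank}\mathbf{M}_r(\bar{y})=1$, then $$\bar{x}:=\frac{1}{\bar{y}_0}\bigl(L_{\bar{y}}(x_1),\ldots,L_{\bar{y}}(x_n)\bigr)$$ is an optimal solution to the problem (FP).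
   Context: $\|\cdot\|$ is the Euclidean norm on $\mathbb{R}^n$. $\Sigma[x]_{2r}$ denotes the cone of real polynomials in $x=(x_1,\ldots,x_n)$ of degree at most $2r$ that are sums of squares of real polynomials; $\mathbb{R}[x]_{2r}$ is the space of real polynomials of degree at most $2r$. For $k\in\mathbb{N}$ (nonnegative integers), $\mathbb{N}^n_k:=\{\alpha\in\mathbb{N}^n\mid \alpha_1+\cdots+\alpha_n\le k\}$ and $s(n,k):=\binom{n+k}{n}$ is its cardinality. For $y=(y_\alpha)_{\alpha\in\mathbb{N}^n_{2r}}\in\mathbb{R}^{s(n,2r)}$: the linear functional $L_y:\mathbb{R}[x]_{2r}\to\mathbb{R}$ is $L_y(p):=\sum_{\alpha\in\mathbb{N}^n_{2r}}p_\alpha y_\alpha$ for $p=\sum_\alpha p_\alpha x^\alpha$; the moment matrix $\mathbf{M}_r(y)$ is the symmetric matrix indexed by $\mathbb{N}^n_r$ with entries $\mathbf{M}_r(y)(\alpha,\beta)=y_{\alpha+\beta}$; $y_0$ is the entry of $y$ with index $\alpha=0$. $M\succeq 0$ means $M$ is positive semidefinite. (The functional $L_y$ is unrelated to the real constant $L$.) (FP) is the fractional program $\inf_{x\in K}\frac{f(x)}{g(x)}$. For each integer $r\ge d$, let $\Theta_r(x):=\sum_{j=1}^n (x_j/L)^{2r}$. (D$_r$) is the problem, in the variables $\lambda\in\mathbb{R}^m$, $\gamma\in\mathbb{R}$, $\eta\in\mathbb{R}$: maximize $\gamma-C\eta$ subject to $f+\sum_{i=1}^m\lambda_i h_i-\gamma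 g+\eta(1+\Theta_r)\in\Sigma[x]_{2r}$, $\;\lambda_i\ge 0$ for $i=1,\ldots,m$, $\;\gamma\ge 0$, $\;\eta\ge 0$. (Q$_r$) is the problem, in the variable $y\in\mathbb{R}^{s(n,2r)}$: minimize $L_y(f)$ subject to $L_y(h_i)\le 0$ for $i=1,\ldots,m$, $\;L_y(1+\Theta_r)\le C$, $\;1-L_y(g)\le 0$, and $\mathbf{M}_r(y)\succeq 0$. *)

theory Defs
  imports "HOL-Analysis.Analysis" "HOL-Analysis.Finite_Function_Topology"
begin

text \<open>
  A real polynomial in the variables \<open>x $ i\<close>, \<open>i :: 'n\<close>, is the finitely supported map from
  exponent vectors to coefficients; the ring structure is the convolution product of
  \<^theory>\<open>HOL-Library.Poly_Mapping\<close>, and scaling by a real is \<open>scaleR\<close>.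
\<close>

type_synonym 'n monom = "'n \<Rightarrow>\<^sub>0 nat"
type_synonym 'n rpoly = "'n monom \<Rightarrow>\<^sub>0 real"

definition monom_deg :: "('n::finite) monom \<Rightarrow> nat" where
  "monom_deg \<alpha> = (\<Sum>i\<in>UNIV. Poly_Mapping.lookup \<alpha> i)"

definition monoms_upto :: "nat \<Rightarrow> ('n::finite) monom set" where
  "monoms_upto k = {\<alpha>. monom_deg \<alpha> \<le> k}"

definition polys_upto :: "nat \<Rightarrow> ('n::finite) rpoly set" where
  "polys_upto k = {p. Poly_Mapping.keys p \<subseteq> monoms_upto k}"

definition poly_eval :: "('n::finite) rpoly \<Rightarrow> real ^ 'n \<Rightarrow> real" where
  "poly_eval p x =
     (\<Sum>\<alpha>\<in>Poly_Mapping.keys p.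
        Poly_Mapping.lookup p \<alpha> * (\<Prod>i\<in>UNIV. (x $ i) ^ Poly_Mapping.lookup \<alpha> i))"

definition pvar :: "'n \<Rightarrow> 'n rpoly" where
  "pvar i = Poly_Mapping.single (Poly_Mapping.single i 1) 1"

definition sos_upto :: "nat \<Rightarrow> ('n::finite) rpoly set" where
  "sos_upto k = {p \<in> polys_upto k. \<exists>qs. p = (\<Sum>q\<leftarrow>qs. q ^ 2)}"

text \<open>
  A vector indexed by \<open>monoms_upto k\<close> is represented by the finitely supported map that is
  zero off the index set, so that the library's vector space structure applies.
\<close>

definition moment_vectors :: "nat \<Rightarrow> (('n::finite) monom \<Rightarrow>\<^sub>0 real) set" where
  "moment_vectors k = {y. Poly_Mapping.keys y \<subseteq> monoms_upto k}"

definition riesz :: "nat \<Rightarrow> (('n::finite) monom \<Rightarrow>\<^sub>0 real) \<Rightarrow> 'n rpoly \<Rightarrow> real" where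
  "riesz r y p =
     (\<Sum>\<alpha>\<in>monoms_upto (2 * r). Poly_Mapping.lookup p \<alpha> * Poly_Mapping.lookup y \<alpha>)"

text \<open>
  The moment matrix of order \<open>r\<close> is the restriction of the following function to rows and
  columns in \<open>monoms_upto r\<close>. Since its size varies with \<open>r\<close>, matrices are functions
  considered on an explicit finite index set.
\<close>

definition moment_matrix ::
  "(('n::finite) monom \<Rightarrow>\<^sub>0 real) \<Rightarrow> 'n monom \<Rightarrow> 'n monom \<Rightarrow> real" where
  "moment_matrix y \<alpha> \<beta> = Poly_Mapping.lookup y (\<alpha> + \<beta>)"

definition psd_on :: "'i set \<Rightarrow> ('i \<Rightarrow> 'i \<Rightarrow> real) \<Rightarrow> bool" where
  "psd_on I M \<longleftrightarrow>
     (\<forall>i\<in>I. \<forall>j\<in>I. M i j = M j i) \<and>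
     (\<forall>v. 0 \<le> (\<Sum>i\<in>I. \<Sum>j\<in>I. v i * M i j * v j))"

definition matrix_column :: "'i set \<Rightarrow> ('i \<Rightarrow> 'j \<Rightarrow> real) \<Rightarrow> 'j \<Rightarrow> ('i \<Rightarrow>\<^sub>0 real)" where
  "matrix_column I M j = (\<Sum>i\<in>I. Poly_Mapping.single i (M i j))"

definition rank_on :: "'i set \<Rightarrow> 'j set \<Rightarrow> ('i \<Rightarrow> 'j \<Rightarrow> real) \<Rightarrow> nat" where
  "rank_on I J M = dim (matrix_column I M ` J)"

definition Theta :: "real \<Rightarrow> nat \<Rightarrow> ('n::finite) rpoly" where
  "Theta L r = (\<Sum>j\<in>UNIV. ((1 / L) *\<^sub>R pvar j) ^ (2 * r))"

definition feasible_set :: "(nat \<Rightarrow> ('n::finite) rpoly) \<Rightarrow> nat \<Rightarrow> (real ^ 'n) set" where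
  "feasible_set h m = {x. \<forall>i\<in>{1..m}. poly_eval (h i) x \<le> 0}"

text \<open>
  The order-\<open>r\<close> relaxation of minimizing \<open>f / g\<close> over \<open>feasible_set h m\<close>: the sum-of-squares
  problem maximizes \<open>dual_objective C\<close> over \<open>dual_feasible f g h m L r\<close> (triples
  \<open>(l, \<gamma>, \<eta>)\<close>, with multipliers \<open>l\<close>), and the moment problem minimizes
  \<open>riesz r y f\<close> over \<open>y \<in> primal_feasible g h m L C r\<close>.
\<close>

definition dual_feasible ::
  "('n::finite) rpoly \<Rightarrow> 'n rpoly \<Rightarrow> (nat \<Rightarrow> 'n rpoly) \<Rightarrow> nat \<Rightarrow> real \<Rightarrow> nat
     \<Rightarrow> ((nat \<Rightarrow> real) \<times> real \<times> real) set" where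
  "dual_feasible f g h m L r =
     {(l, \<gamma>, \<eta>). l \<in> {1..m} \<rightarrow>\<^sub>E {0..} \<and> 0 \<le> \<gamma> \<and> 0 \<le> \<eta> \<and>
        f + (\<Sum>i=1..m. l i *\<^sub>R h i) - \<gamma> *\<^sub>R g + \<eta> *\<^sub>R (1 + Theta L r) \<in> sos_upto (2 * r)}"

definition dual_objective :: "real \<Rightarrow> (nat \<Rightarrow> real) \<times> real \<times> real \<Rightarrow> real" where
  "dual_objective C = (\<lambda>(l, \<gamma>, \<eta>). \<gamma> - C * \<eta>)"

definition primal_feasible ::
  "('n::finite) rpoly \<Rightarrow> (nat \<Rightarrow> 'n rpoly) \<Rightarrow> nat \<Rightarrow> real \<Rightarrow> real \<Rightarrow> nat
     \<Rightarrow> ('n monom \<Rightarrow>\<^sub>0 real) set" where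
  "primal_feasible g h m L C r =
     {y \<in> moment_vectors (2 * r).
        (\<forall>i\<in>{1..m}. riesz r y (h i) \<le> 0) \<and>
        riesz r y (1 + Theta L r) \<le> C \<and>
        1 - riesz r y g \<le> 0 \<and>
        psd_on (monoms_upto r) (moment_matrix y)}"

end

theory Submission
  imports Defs
begin

text \<open>
  \<^emph>\<open>Duality.\<close> The two relaxations are a dual pair of semidefinite programs, and a Slater point of
  the moment program forces the sum-of-squares program to attain the common value. The general
  fact behind this is \<open>psd_farkas\<close>: if a linear pencil \<open>A x\<close> of symmetric matrices contains a
  positive definite matrix, then each linear functional \<open>\<phi>\<close> that is nonnegative wherever \<open>A x\<close> is
  positive semidefinite has the form \<open>\<phi> x = (\<Sum>q. q\<^sup>T (A x) q)\<close>. It is proved algebraically: \<open>\<phi>\<close> is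
  extended to all matrices one entry at a time as in the extension theorem of M. Riesz, and the
  extended functional is represented by a positive semidefinite matrix, which is a sum of rank-one
  matrices. Applied to the homogenized functional \<open>(y, t) \<mapsto> L\<^sub>y(f) - v t\<close>, with \<open>v\<close> the infimum of
  the moment program and the scalar constraints placed on the diagonal, it delivers the squares and
  the multipliers at once (\<open>dual_feasible_attains_lower_bound\<close>).

  Three facts supply the hypotheses. The objective \<open>L\<^sub>y(f)\<close> is bounded below, and \<open>y = 0\<close> in the case
  \<open>t = 0\<close>, because the bound on \<open>L\<^sub>y(1 + \<Theta>)\<close> bounds each entry of \<open>y\<close> (\<open>moment_bound\<close>). A strictly
  feasible \<open>y\<close> is a multiple of the moments of a Slater point plus a small multiple of a vector with
  positive definite moment matrix (\<open>strictly_feasible_moments\<close>); the multiple exists because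
  \<open>1 / g < C / 2\<close> on \<open>K\<close> and \<open>1 + \<Theta> \<le> 2\<close> there. Weak duality uses that the summands of a sum of
  squares of degree at most \<open>2 r\<close> have degree at most \<open>r\<close> (\<open>sos_summands_degree\<close>).

  \<^emph>\<open>Exactness.\<close> If the moment matrix has rank one, its vanishing \<open>2 \<times> 2\<close> minors say that \<open>y / y\<^sub>0\<close> is
  multiplicative, so \<open>y\<close> is \<open>y\<^sub>0\<close> times the moment vector of the point \<open>x = (L\<^sub>y(x\<^sub>i) / y\<^sub>0)\<^sub>i\<close>
  (\<open>rank_one_riesz\<close>). The constraints on \<open>y\<close> then say that \<open>x \<in> K\<close> and \<open>y\<^sub>0 g(x) \<ge> 1\<close>, whence
  \<open>f(x) / g(x) \<le> y\<^sub>0 f(x) = L\<^sub>y(f)\<close>. For each \<open>z \<in> K\<close> the moments of \<open>z\<close> divided by \<open>g(z)\<close> are feasible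
  with value \<open>f(z) / g(z)\<close>, so optimality of \<open>y\<close> gives \<open>L\<^sub>y(f) \<le> f(z) / g(z)\<close>.
\<close>

section \<open>Semidefinite duality\<close>

definition quad_form :: "'i set \<Rightarrow> ('i \<Rightarrow> 'i \<Rightarrow> real) \<Rightarrow> ('i \<Rightarrow> real) \<Rightarrow> real" where
  "quad_form I M v = (\<Sum>i\<in>I. \<Sum>j\<in>I. v i * M i j * v j)"

lemma psd_on_iff_quad_form:
  "psd_on I M \<longleftrightarrow> (\<forall>i\<in>I. \<forall>j\<in>I. M i j = M j i) \<and> (\<forall>v. 0 \<le> quad_form I M v)"
  by (simp add: psd_on_def quad_form_def)

lemma quad_form_cong:
  assumes "\<And>i j. i \<in> I \<Longrightarrow> j \<in> I \<Longrightarrow> M i j = N i j" "\<And>i. i \<in> I \<Longrightarrow> v i = w i"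
  shows "quad_form I M v = quad_form I N w"
  unfolding quad_form_def using assms by (intro sum.cong) auto

lemma quad_form_add:
  "quad_form I (\<lambda>i j. M i j + N i j) v = quad_form I M v + quad_form I N v"
  by (simp add: quad_form_def algebra_simps sum.distrib)

lemma quad_form_scale:
  "quad_form I (\<lambda>i j. c * M i j) v = c * quad_form I M v"
  by (simp add: quad_form_def sum_distrib_left mult_ac)

lemma quad_form_rank_one:
  "quad_form I (\<lambda>i j. q i * q j) v = (\<Sum>i\<in>I. q i * v i) ^ 2"
  by (simp add: quad_form_def power2_eq_square sum_product mult_ac)

lemma quad_form_insert:
  assumes "finite I" "k \<notin> I" "\<And>i. i \<in> I \<Longrightarrow> M i k = M k i"
  shows "quad_form (insert k I) M v =
    quad_form I M v + 2 * v k * (\<Sum>i\<in>I. M k i * v i) + M k k * (v k)\<^sup>2"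
proof -
  have "(\<Sum>i\<in>I. v i * M i k * v k) = v k * (\<Sum>i\<in>I. M k i * v i)"
    using assms(3) by (simp add: sum_distrib_left mult_ac)
  moreover have "(\<Sum>i\<in>I. v k * M k i * v i) = v k * (\<Sum>i\<in>I. M k i * v i)"
    by (simp add: sum_distrib_left mult_ac)
  ultimately show ?thesis
    using assms(1,2) by (simp add: quad_form_def sum.distrib algebra_simps power2_eq_square)
qed

lemma quad_form_entry_bound:
  assumes "finite I"
  shows "\<bar>quad_form I M v\<bar> \<le> (\<Sum>i\<in>I. \<Sum>j\<in>I. \<bar>M i j\<bar>) * (\<Sum>i\<in>I. (v i)\<^sup>2)"
proof -
  have sq: "\<bar>v i\<bar> * \<bar>v j\<bar> \<le> (\<Sum>i\<in>I. (v i)\<^sup>2)" if "i \<in> I" "j \<in> I" for i j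
  proof -
    have le: "(v k)\<^sup>2 \<le> (\<Sum>i\<in>I. (v i)\<^sup>2)" if "k \<in> I" for k
      using that assms by (intro member_le_sum) auto
    have "2 * (\<bar>v i\<bar> * \<bar>v j\<bar>) \<le> (v i)\<^sup>2 + (v j)\<^sup>2"
      using sum_squares_bound[of "\<bar>v i\<bar>" "\<bar>v j\<bar>"] by simp
    with le[OF that(1)] le[OF that(2)] show ?thesis by linarith
  qed
  have "\<bar>quad_form I M v\<bar> \<le> (\<Sum>i\<in>I. \<Sum>j\<in>I. \<bar>v i * M i j * v j\<bar>)"
    unfolding quad_form_def by (rule order_trans[OF sum_abs sum_mono]) (rule sum_abs)
  also have "\<dots> \<le> (\<Sum>i\<in>I. \<Sum>j\<in>I. \<bar>M i j\<bar> * (\<Sum>i\<in>I. (v i)\<^sup>2))"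
  proof (intro sum_mono)
    fix i j assume "i \<in> I" "j \<in> I"
    from mult_left_mono[OF sq[OF this], of "\<bar>M i j\<bar>"]
    show "\<bar>v i * M i j * v j\<bar> \<le> \<bar>M i j\<bar> * (\<Sum>i\<in>I. (v i)\<^sup>2)"
      by (simp add: abs_mult mult_ac)
  qed
  also have "\<dots> = (\<Sum>i\<in>I. \<Sum>j\<in>I. \<bar>M i j\<bar>) * (\<Sum>i\<in>I. (v i)\<^sup>2)"
    by (simp add: sum_distrib_right)
  finally show ?thesis .
qed

lemma affine_nonneg_imp_slope_zero:
  fixes a b :: real
  assumes "\<And>s. 0 \<le> a + s * b"
  shows "b = 0"
proof (rule ccontr)
  assume "b \<noteq> 0"
  with assms[of "- (a + 1) / b"] show False by simp
qed

text \<open>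
  Cholesky factorization by induction on the index set: the row of the new index \<open>k\<close>, divided by the
  square root of its diagonal entry, is split off as a rank-one summand, and what remains lives on
  the old indices. If that diagonal entry is zero, positivity makes the whole row vanish, and the
  default \<open>x / 0 = 0\<close> makes the same formula give the right summand \<open>0\<close>.
\<close>
lemma psd_on_decomposition:
  assumes "finite I" "psd_on I M"
  shows "\<exists>qs. \<forall>i\<in>I. \<forall>j\<in>I. M i j = (\<Sum>q\<leftarrow>qs. q i * q j)"
  using assms
proof (induction I arbitrary: M rule: finite_induct)
  case empty
  then show ?case by simp
next
  case (insert k I)
  have sym: "M i j = M j i" if "i \<in> insert k I" "j \<in> insert k I" for i j
    using insert.prems that unfolding psd_on_iff_quad_form by blast
  have form: "quad_form (insert k I) M v =
      quad_form I M v + 2 * v k * (\<Sum>i\<in>I. M k i * v i) + M k k * (v k)\<^sup>2" for v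
    using insert.hyps sym by (intro quad_form_insert) auto
  have nonneg: "0 \<le> quad_form I M v + 2 * v k * (\<Sum>i\<in>I. M k i * v i) + M k k * (v k)\<^sup>2" for v
    using insert.prems form unfolding psd_on_iff_quad_form by metis
  have nonneg': "0 \<le> quad_form I M w + 2 * s * (\<Sum>i\<in>I. M k i * w i) + M k k * s\<^sup>2" for w s
  proof -
    have "quad_form I M (w(k := s)) = quad_form I M w"
      using insert.hyps by (intro quad_form_cong) auto
    moreover have "(\<Sum>i\<in>I. M k i * (w(k := s)) i) = (\<Sum>i\<in>I. M k i * w i)"
      using insert.hyps by (intro sum.cong) auto
    ultimately show ?thesis using nonneg[of "w(k := s)"] by simp
  qed
  have diag: "0 \<le> M k k"
    using nonneg'[of "\<lambda>_. 0" 1] by (simp add: quad_form_def)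
  define q where "q i = M k i / sqrt (M k k)" for i
  have row: "M k i = q k * q i" if "i \<in> insert k I" for i
  proof (cases "M k k = 0")
    case True
    have "M k i = 0"
    proof (cases "i = k")
      case False
      with that have iI: "i \<in> I" by simp
      let ?e = "\<lambda>j. if j = i then 1 else 0 :: real"
      have "0 \<le> quad_form I M ?e + s * (2 * M k i)" for s
        using nonneg'[of ?e s] True iI insert.hyps by (simp add: if_distrib cong: if_cong)
      then show ?thesis using affine_nonneg_imp_slope_zero[of _ "2 * M k i"] by auto
    qed (use True in simp)
    then show ?thesis by (simp add: q_def True)
  next
    case False
    then have "sqrt (M k k) * sqrt (M k k) = M k k" "sqrt (M k k) \<noteq> 0" using diag by auto
    then show ?thesis by (simp add: q_def field_simps)
  qed
  have "psd_on I (\<lambda>i j. M i j + (- 1) * (q i * q j))"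
    unfolding psd_on_iff_quad_form
  proof (intro conjI ballI allI)
    fix i j assume "i \<in> I" "j \<in> I"
    then show "M i j + (- 1) * (q i * q j) = M j i + (- 1) * (q j * q i)" using sym by simp
  next
    fix w
    let ?m = "\<Sum>i\<in>I. M k i * w i"
    have eq: "quad_form I (\<lambda>i j. M i j + (- 1) * (q i * q j)) w = quad_form I M w - (\<Sum>i\<in>I. q i * w i)\<^sup>2"
      unfolding quad_form_add quad_form_scale quad_form_rank_one by simp
    have m: "?m = q k * (\<Sum>i\<in>I. q i * w i)"
      using row by (simp add: sum_distrib_left mult_ac)
    show "0 \<le> quad_form I (\<lambda>i j. M i j + (- 1) * (q i * q j)) w"
    proof (cases "M k k = 0")
      case True
      then have "q i = 0" for i by (simp add: q_def)
      then show ?thesis unfolding eq using nonneg'[of w 0] by simp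
    next
      case False
      then have qk: "q k \<noteq> 0" using row[of k] by auto
      \<comment> \<open>The minimizing value of the coordinate at \<open>k\<close> completes the square.\<close>
      show ?thesis unfolding eq
        using nonneg'[of w "- (\<Sum>i\<in>I. q i * w i) / q k"] qk row[of k]
        unfolding m by (simp add: field_simps power2_eq_square)
    qed
  qed
  from insert.IH[OF this] obtain qs
    where qs: "\<forall>i\<in>I. \<forall>j\<in>I. M i j + (- 1) * (q i * q j) = (\<Sum>q\<leftarrow>qs. q i * q j)" by blast
  \<comment> \<open>The old vectors are arbitrary at \<open>k\<close>; the row of \<open>k\<close> belongs to \<open>q\<close> alone.\<close>
  let ?qs = "q # map (\<lambda>p. p(k := 0)) qs"
  have "M i j = (\<Sum>q\<leftarrow>?qs. q i * q j)" if ij: "i \<in> insert k I" "j \<in> insert k I" for i j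
  proof (cases "i = k \<or> j = k")
    case True
    then have "(\<Sum>p\<leftarrow>qs. (p(k := 0)) i * (p(k := 0)) j) = 0"
      by (induction qs) auto
    moreover have "M i j = q i * q j"
      using True row ij sym by (metis mult.commute)
    ultimately show ?thesis by (simp add: o_def)
  next
    case False
    then have "M i j = q i * q j + (\<Sum>p\<leftarrow>qs. p i * p j)" using qs[rule_format, of i j] ij by auto
    then show ?thesis using False by (simp add: o_def)
  qed
  then show ?case by blast
qed

text \<open>
  The extension step of M. Riesz, iterated over a finite set \<open>S\<close> of matrix entries. Instead of a
  growing subspace of matrices, the pencil \<open>A x\<close> is perturbed by an arbitrary \<open>Z\<close> supported on \<open>S\<close>,
  and \<open>c\<close> lists the values of the extended functional on the unit matrices of \<open>S\<close>. The value at
  a new entry must lie above one set of reals and below another; positivity of the functional so far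
  separates the two, and definiteness of \<open>A u\<close> makes both nonempty.
\<close>
lemma psd_functional_extension:
  fixes A :: "'v::real_vector \<Rightarrow> 'i \<Rightarrow> 'i \<Rightarrow> real" and \<phi> :: "'v \<Rightarrow> real"
  assumes I: "finite I" and lin: "linear \<phi>" "\<And>i j. i \<in> I \<Longrightarrow> j \<in> I \<Longrightarrow> linear (\<lambda>x. A x i j)"
    and pos: "\<And>x. (\<And>v. 0 \<le> quad_form I (A x) v) \<Longrightarrow> 0 \<le> \<phi> x"
    and e: "0 < e" "\<And>v. e * (\<Sum>i\<in>I. (v i)\<^sup>2) \<le> quad_form I (A u) v"
    and S: "finite S"
  shows "\<exists>c. \<forall>x Z. (\<forall>p. p \<notin> S \<longrightarrow> Z p = 0) \<longrightarrow>
    (\<forall>v. 0 \<le> quad_form I (\<lambda>i j. A x i j + Z (i, j)) v) \<longrightarrow> 0 \<le> \<phi> x + (\<Sum>p\<in>S. c p * Z p)"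
  using S
proof (induction S rule: finite_induct)
  case empty
  have "0 \<le> \<phi> x" if "\<forall>p. p \<notin> {} \<longrightarrow> Z p = 0" "\<forall>v. 0 \<le> quad_form I (\<lambda>i j. A x i j + Z (i, j)) v"
    for x and Z :: "'i \<times> 'i \<Rightarrow> real"
    using that by (intro pos) simp
  then show ?case by simp
next
  case (insert p S)
  define psd where "psd x Z \<longleftrightarrow> (\<forall>v. 0 \<le> quad_form I (\<lambda>i j. A x i j + Z (i, j)) v)"
    for x and Z :: "'i \<times> 'i \<Rightarrow> real"
  from insert.IH obtain c where
    IH: "\<And>x Z. (\<forall>p. p \<notin> S \<longrightarrow> Z p = 0) \<Longrightarrow> psd x Z \<Longrightarrow> 0 \<le> \<phi> x + (\<Sum>p\<in>S. c p * Z p)"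
    unfolding psd_def by blast
  have psd_add: "psd (x + x') (\<lambda>p. Z p + Z' p)" if "psd x Z" "psd x' Z'" for x x' Z Z'
    unfolding psd_def
  proof
    fix v
    have "quad_form I (\<lambda>i j. A (x + x') i j + (Z (i, j) + Z' (i, j))) v
        = quad_form I (\<lambda>i j. (A x i j + Z (i, j)) + (A x' i j + Z' (i, j))) v"
      by (intro quad_form_cong) (auto simp: linear_add[OF lin(2)])
    then show "0 \<le> quad_form I (\<lambda>i j. A (x + x') i j + (Z (i, j) + Z' (i, j))) v"
      using that(1)[unfolded psd_def, rule_format, of v] that(2)[unfolded psd_def, rule_format, of v]
      by (simp add: quad_form_add)
  qed
  have psd_scale: "psd (s *\<^sub>R x) (\<lambda>p. s * Z p)" if "psd x Z" "0 \<le> s" for s x Z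
    unfolding psd_def
  proof
    fix v
    have "quad_form I (\<lambda>i j. A (s *\<^sub>R x) i j + s * Z (i, j)) v
        = quad_form I (\<lambda>i j. s * (A x i j + Z (i, j))) v"
      by (intro quad_form_cong) (auto simp: linear_scale[OF lin(2)] algebra_simps)
    then show "0 \<le> quad_form I (\<lambda>i j. A (s *\<^sub>R x) i j + s * Z (i, j)) v"
      using that unfolding quad_form_scale psd_def by simp
  qed
  have unit: "\<exists>x. psd x Z" for Z
  proof -
    let ?b = "\<Sum>i\<in>I. \<Sum>j\<in>I. \<bar>Z (i, j)\<bar>"
    have "psd ((?b / e) *\<^sub>R u) Z"
      unfolding psd_def
    proof
      fix v :: "'i \<Rightarrow> real"
      let ?n = "\<Sum>i\<in>I. (v i)\<^sup>2"
      have "quad_form I (\<lambda>i j. A ((?b / e) *\<^sub>R u) i j + Z (i, j)) v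
        = quad_form I (\<lambda>i j. (?b / e) * A u i j + Z (i, j)) v"
        by (intro quad_form_cong) (auto simp: linear_scale[OF lin(2)])
      also have "\<dots> = (?b / e) * quad_form I (A u) v + quad_form I (\<lambda>i j. Z (i, j)) v"
        unfolding quad_form_add quad_form_scale ..
      also have "\<dots> \<ge> (?b / e) * (e * ?n) - ?b * ?n"
        using mult_left_mono[OF e(2)[of v], of "?b / e"] quad_form_entry_bound[OF I, of "\<lambda>i j. Z (i, j)" v]
          e(1) by (simp add: sum_nonneg)
      finally show "0 \<le> quad_form I (\<lambda>i j. A ((?b / e) *\<^sub>R u) i j + Z (i, j)) v"
        using e(1) by simp
    qed
    then show ?thesis by blast
  qed
  define E where "E q = (if q = p then 1 else 0 :: real)" for q
  define val where "val x Z = \<phi> x + (\<Sum>q\<in>S. c q * Z q)" for x Z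
  define Lo where "Lo = {- val x Z | x Z. (\<forall>q. q \<notin> S \<longrightarrow> Z q = 0) \<and> psd x (\<lambda>q. Z q + E q)}"
  define Up where "Up = {val x Z | x Z. (\<forall>q. q \<notin> S \<longrightarrow> Z q = 0) \<and> psd x (\<lambda>q. Z q - E q)}"
  have Lo_le_Up: "l \<le> w" if lw: "l \<in> Lo" "w \<in> Up" for l w
  proof -
    obtain x Z where 1: "l = - val x Z" "\<forall>q. q \<notin> S \<longrightarrow> Z q = 0" "psd x (\<lambda>q. Z q + E q)"
      using lw(1) unfolding Lo_def by blast
    obtain x' Z' where 2: "w = val x' Z'" "\<forall>q. q \<notin> S \<longrightarrow> Z' q = 0" "psd x' (\<lambda>q. Z' q - E q)"
      using lw(2) unfolding Up_def by blast
    from psd_add[OF 1(3) 2(3)] have "psd (x + x') (\<lambda>q. Z q + Z' q)" by simp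
    then have "0 \<le> \<phi> (x + x') + (\<Sum>q\<in>S. c q * (Z q + Z' q))"
      using 1(2) 2(2) by (intro IH) auto
    then show ?thesis
      unfolding 1 2 val_def using lin(1) by (simp add: linear_add sum.distrib algebra_simps)
  qed
  have "Lo \<noteq> {}" "Up \<noteq> {}"
    using unit[of "\<lambda>q. 0 + E q"] unit[of "\<lambda>q. 0 - E q"] unfolding Lo_def Up_def by fastforce+
  then have "\<exists>a. (\<forall>l\<in>Lo. l \<le> a) \<and> (\<forall>w\<in>Up. a \<le> w)"
    using Lo_le_Up by (intro exI[of _ "Sup Lo"]) (auto intro!: cSup_upper cSup_least bdd_aboveI)
  then obtain a where a: "\<And>l. l \<in> Lo \<Longrightarrow> l \<le> a" "\<And>w. w \<in> Up \<Longrightarrow> a \<le> w" by blast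
  have "0 \<le> \<phi> x + (\<Sum>q\<in>insert p S. (c(p := a)) q * Z q)"
    if Z: "\<forall>q. q \<notin> insert p S \<longrightarrow> Z q = 0" and xZ: "psd x Z" for x Z
  proof -
    define s where "s = Z p"
    define Z' where "Z' = Z(p := 0)"
    have Z'0: "\<forall>q. q \<notin> S \<longrightarrow> Z' q = 0" using Z insert.hyps unfolding Z'_def by auto
    have "(\<Sum>q\<in>S. (c(p := a)) q * Z q) = (\<Sum>q\<in>S. c q * Z' q)"
      using insert.hyps unfolding Z'_def by (intro sum.cong) auto
    then have goal: "\<phi> x + (\<Sum>q\<in>insert p S. (c(p := a)) q * Z q) = val x Z' + a * s"
      using insert.hyps by (simp add: val_def s_def)
    have scaled: "val (t *\<^sub>R x) (\<lambda>q. t * Z' q) = t * val x Z'" for t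
      using lin(1) by (simp add: val_def linear_scale algebra_simps sum_distrib_left)
    consider "s = 0" | "s > 0" | "s < 0" by linarith
    then have "0 \<le> val x Z' + a * s"
    proof cases
      case 1
      then have "Z' = Z" unfolding Z'_def s_def by auto
      with IH[OF Z'0, of x] xZ 1 show ?thesis by (simp add: val_def)
    next
      case 2
      have "(\<lambda>q. 1 / s * Z q) = (\<lambda>q. 1 / s * Z' q + E q)"
        using 2 by (auto simp: Z'_def E_def s_def)
      then have "psd ((1 / s) *\<^sub>R x) (\<lambda>q. 1 / s * Z' q + E q)"
        using psd_scale[OF xZ, of "1 / s"] 2 by simp
      then have "- val ((1 / s) *\<^sub>R x) (\<lambda>q. 1 / s * Z' q) \<in> Lo"
        unfolding Lo_def using Z'0 by fastforce
      from a(1)[OF this] show ?thesis unfolding scaled using 2 by (simp add: field_simps)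
    next
      case 3
      have "(\<lambda>q. - 1 / s * Z q) = (\<lambda>q. - 1 / s * Z' q - E q)"
        using 3 by (auto simp: Z'_def E_def s_def)
      then have "psd ((- 1 / s) *\<^sub>R x) (\<lambda>q. - 1 / s * Z' q - E q)"
        using psd_scale[OF xZ, of "- 1 / s"] 3 by simp
      then have "val ((- 1 / s) *\<^sub>R x) (\<lambda>q. - 1 / s * Z' q) \<in> Up"
        unfolding Up_def using Z'0 by fastforce
      from a(2)[OF this] show ?thesis unfolding scaled using 3 by (simp add: field_simps)
    qed
    then show ?thesis unfolding goal .
  qed
  then show ?case unfolding psd_def by blast
qed

text \<open>
  With all entries free, the extended functional \<open>\<phi> x + (\<Sum>p. c p * Z p)\<close> is nonnegative whenever
  \<open>A x + Z\<close> is positive semidefinite. The choice \<open>Z = - A x\<close>, for \<open>x\<close> and \<open>- x\<close>, identifies \<open>\<phi>\<close> with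
  the pairing of \<open>c\<close> and \<open>A\<close>; the choice \<open>x = 0\<close> with \<open>Z\<close> of rank one shows that \<open>c\<close> is positive
  semidefinite.
\<close>
theorem psd_farkas:
  fixes A :: "'v::real_vector \<Rightarrow> 'i \<Rightarrow> 'i \<Rightarrow> real" and \<phi> :: "'v \<Rightarrow> real"
  assumes I: "finite I" and lin: "linear \<phi>" "\<And>i j. i \<in> I \<Longrightarrow> j \<in> I \<Longrightarrow> linear (\<lambda>x. A x i j)"
    and sym: "\<And>x i j. i \<in> I \<Longrightarrow> j \<in> I \<Longrightarrow> A x i j = A x j i"
    and pos: "\<And>x. (\<And>v. 0 \<le> quad_form I (A x) v) \<Longrightarrow> 0 \<le> \<phi> x"
    and e: "0 < e" "\<And>v. e * (\<Sum>i\<in>I. (v i)\<^sup>2) \<le> quad_form I (A u) v"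
  shows "\<exists>qs. \<forall>x. \<phi> x = (\<Sum>q\<leftarrow>qs. quad_form I (A x) q)"
proof -
  obtain c where c: "\<And>x Z. \<forall>p. p \<notin> I \<times> I \<longrightarrow> Z p = 0 \<Longrightarrow>
    \<forall>v. 0 \<le> quad_form I (\<lambda>i j. A x i j + Z (i, j)) v \<Longrightarrow> 0 \<le> \<phi> x + (\<Sum>p\<in>I \<times> I. c p * Z p)"
    using psd_functional_extension[OF I lin pos e, of "I \<times> I"] I by blast
  have le: "(\<Sum>i\<in>I. \<Sum>j\<in>I. c (i, j) * A x i j) \<le> \<phi> x" for x
  proof -
    let ?Z = "\<lambda>p. if p \<in> I \<times> I then - A x (fst p) (snd p) else 0"
    have "quad_form I (\<lambda>i j. A x i j + ?Z (i, j)) v = quad_form I (\<lambda>i j. 0) v" for v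
      by (intro quad_form_cong) auto
    then have "quad_form I (\<lambda>i j. A x i j + ?Z (i, j)) v = 0" for v
      by (simp add: quad_form_def)
    then have "0 \<le> \<phi> x + (\<Sum>p\<in>I \<times> I. c p * ?Z p)"
      by (intro c) auto
    also have "(\<Sum>p\<in>I \<times> I. c p * ?Z p) = (\<Sum>p\<in>I \<times> I. - (case p of (i, j) \<Rightarrow> c (i, j) * A x i j))"
      by (intro sum.cong) auto
    also have "\<dots> = - (\<Sum>i\<in>I. \<Sum>j\<in>I. c (i, j) * A x i j)"
      unfolding sum_negf by (simp add: sum.cartesian_product)
    finally show ?thesis by simp
  qed
  have eq: "\<phi> x = (\<Sum>i\<in>I. \<Sum>j\<in>I. c (i, j) * A x i j)" for x
  proof -
    have "(\<Sum>i\<in>I. \<Sum>j\<in>I. c (i, j) * A (- x) i j) = - (\<Sum>i\<in>I. \<Sum>j\<in>I. c (i, j) * A x i j)"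
      unfolding sum_negf[symmetric] by (intro sum.cong refl) (simp add: linear_neg[OF lin(2)])
    with le[of x] le[of "- x"] show ?thesis using lin(1) by (simp add: linear_neg)
  qed
  \<comment> \<open>Only the symmetric part of \<open>c\<close> pairs with the symmetric matrices \<open>A x\<close>.\<close>
  define B where "B i j = (c (i, j) + c (j, i)) / 2" for i j
  have swap: "(\<Sum>i\<in>I. \<Sum>j\<in>I. c (j, i) * X i j) = (\<Sum>i\<in>I. \<Sum>j\<in>I. c (i, j) * X i j)"
    if "\<And>i j. i \<in> I \<Longrightarrow> j \<in> I \<Longrightarrow> X i j = X j i" for X
    using that by (subst sum.swap) (auto intro!: sum.cong)
  have B: "(\<Sum>i\<in>I. \<Sum>j\<in>I. B i j * X i j) = (\<Sum>i\<in>I. \<Sum>j\<in>I. c (i, j) * X i j)"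
    if "\<And>i j. i \<in> I \<Longrightarrow> j \<in> I \<Longrightarrow> X i j = X j i" for X
  proof -
    have "(\<Sum>i\<in>I. \<Sum>j\<in>I. B i j * X i j)
        = ((\<Sum>i\<in>I. \<Sum>j\<in>I. c (i, j) * X i j) + (\<Sum>i\<in>I. \<Sum>j\<in>I. c (j, i) * X i j)) / 2"
      unfolding B_def sum.distrib[symmetric] sum_divide_distrib
      by (intro sum.cong refl) (simp add: field_simps)
    then show ?thesis using swap[of X, OF that] by simp
  qed
  have "psd_on I B"
    unfolding psd_on_iff_quad_form
  proof (intro conjI ballI allI)
    fix v :: "'i \<Rightarrow> real"
    let ?Z = "\<lambda>p. if p \<in> I \<times> I then v (fst p) * v (snd p) else 0"
    have A0: "A 0 i j = 0" if "i \<in> I" "j \<in> I" for i j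
      using linear_0[OF lin(2)[OF that]] .
    have "quad_form I (\<lambda>i j. A 0 i j + ?Z (i, j)) w = quad_form I (\<lambda>i j. v i * v j) w" for w
      by (intro quad_form_cong) (auto simp: A0)
    then have "0 \<le> \<phi> 0 + (\<Sum>p\<in>I \<times> I. c p * ?Z p)"
      by (intro c) (auto simp: quad_form_rank_one)
    also have "(\<Sum>p\<in>I \<times> I. c p * ?Z p) = (\<Sum>p\<in>I \<times> I. case p of (i, j) \<Rightarrow> c (i, j) * (v i * v j))"
      by (intro sum.cong) auto
    also have "\<dots> = (\<Sum>i\<in>I. \<Sum>j\<in>I. c (i, j) * (v i * v j))"
      by (simp add: sum.cartesian_product)
    also have "\<dots> = quad_form I B v"
      by (subst B[symmetric]) (auto simp: quad_form_def mult_ac)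
    finally show "0 \<le> quad_form I B v" using lin(1) by (simp add: linear_0)
  qed (simp add: B_def)
  from psd_on_decomposition[OF I this] obtain qs
    where qs: "\<And>i j. i \<in> I \<Longrightarrow> j \<in> I \<Longrightarrow> B i j = (\<Sum>q\<leftarrow>qs. q i * q j)" by blast
  have "\<phi> x = (\<Sum>q\<leftarrow>qs. quad_form I (A x) q)" for x
  proof -
    have "\<phi> x = (\<Sum>i\<in>I. \<Sum>j\<in>I. B i j * A x i j)"
      using sym by (simp add: eq B)
    also have "\<dots> = (\<Sum>i\<in>I. \<Sum>j\<in>I. \<Sum>q\<leftarrow>qs. q i * A x i j * q j)"
    proof (intro sum.cong refl)
      fix i j assume "i \<in> I" "j \<in> I"
      moreover have "(\<Sum>q\<leftarrow>qs. q i * q j) * a = (\<Sum>q\<leftarrow>qs. q i * a * q j)" for a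
        by (induction qs) (simp_all add: algebra_simps)
      ultimately show "B i j * A x i j = (\<Sum>q\<leftarrow>qs. q i * A x i j * q j)" using qs by simp
    qed
    also have "\<dots> = (\<Sum>q\<leftarrow>qs. quad_form I (A x) q)"
      by (induction qs) (simp_all add: quad_form_def sum.distrib)
    finally show ?thesis .
  qed
  then show ?thesis by blast
qed

text \<open>
  Scalar constraints enter as diagonal entries of a larger block matrix; a vector then contributes the
  square of its coordinate at such an entry to the multiplier.
\<close>
corollary psd_farkas_with_inequalities:
  fixes A :: "'v::real_vector \<Rightarrow> 'i \<Rightarrow> 'i \<Rightarrow> real" and \<phi> :: "'v \<Rightarrow> real"
    and b :: "'k \<Rightarrow> 'v \<Rightarrow> real"
  assumes I: "finite I" and K: "finite K"
    and lin: "linear \<phi>" "\<And>i j. i \<in> I \<Longrightarrow> j \<in> I \<Longrightarrow> linear (\<lambda>x. A x i j)"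
      "\<And>k. k \<in> K \<Longrightarrow> linear (b k)"
    and sym: "\<And>x i j. i \<in> I \<Longrightarrow> j \<in> I \<Longrightarrow> A x i j = A x j i"
    and pos: "\<And>x. psd_on I (A x) \<Longrightarrow> (\<And>k. k \<in> K \<Longrightarrow> 0 \<le> b k x) \<Longrightarrow> 0 \<le> \<phi> x"
    and e: "0 < e" "\<And>v. e * (\<Sum>i\<in>I. (v i)\<^sup>2) \<le> quad_form I (A u) v"
    and bu: "\<And>k. k \<in> K \<Longrightarrow> 0 < b k u"
  shows "\<exists>qs \<mu>. (\<forall>k. 0 \<le> \<mu> k) \<and>
    (\<forall>x. \<phi> x = (\<Sum>q\<leftarrow>qs. quad_form I (A x) q) + (\<Sum>k\<in>K. \<mu> k * b k x))"
proof -
  define D where "D x i j = (case (i, j) of (Inl i, Inl j) \<Rightarrow> A x i j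
    | (Inr k, Inr l) \<Rightarrow> if k = l then b k x else 0 | _ \<Rightarrow> 0)" for x i j
  let ?J = "I <+> K"
  have form: "quad_form ?J (D x) v = quad_form I (A x) (v \<circ> Inl) + (\<Sum>k\<in>K. b k x * (v (Inr k))\<^sup>2)" for x v
    using I K by (simp add: quad_form_def sum.Plus D_def o_def if_distrib if_distribR mult_ac
        power2_eq_square cong: if_cong)
  define e' where "e' = Min (insert e ((\<lambda>k. b k u) ` K))"
  have e'0: "0 < e'" unfolding e'_def using K e(1) bu by simp
  have e'_le: "e' \<le> e" "\<And>k. k \<in> K \<Longrightarrow> e' \<le> b k u" unfolding e'_def using K by auto
  have "\<exists>qs. \<forall>x. \<phi> x = (\<Sum>q\<leftarrow>qs. quad_form ?J (D x) q)"
  proof (rule psd_farkas[where e = e' and u = u])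
    show "finite ?J" using I K by simp
    show "linear \<phi>" by fact
    show "linear (\<lambda>x. D x i j)" if "i \<in> ?J" "j \<in> ?J" for i j
    proof -
      have "linear (\<lambda>x. if k = l then b k x else 0)" if "k \<in> K" for k l
        using lin(3)[OF that] by (cases "k = l") (simp_all add: linear_zero)
      with that lin(2) show ?thesis by (auto simp: D_def linear_zero)
    qed
    show "D x i j = D x j i" if "i \<in> ?J" "j \<in> ?J" for x i j
      using that sym by (auto simp: D_def)
    show "0 < e'" by fact
    show "e' * (\<Sum>i\<in>?J. (v i)\<^sup>2) \<le> quad_form ?J (D u) v" for v
    proof -
      have "e' * (\<Sum>i\<in>I. ((v \<circ> Inl) i)\<^sup>2) \<le> quad_form I (A u) (v \<circ> Inl)"
        by (rule order_trans[OF mult_right_mono[OF e'_le(1)] e(2)]) (simp add: sum_nonneg)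
      moreover have "e' * (\<Sum>k\<in>K. (v (Inr k))\<^sup>2) \<le> (\<Sum>k\<in>K. b k u * (v (Inr k))\<^sup>2)"
        unfolding sum_distrib_left by (intro sum_mono mult_right_mono e'_le) auto
      ultimately show ?thesis
        unfolding form using I K by (simp add: sum.Plus algebra_simps)
    qed
    show "0 \<le> \<phi> x" if D: "\<And>v. 0 \<le> quad_form ?J (D x) v" for x
    proof (rule pos)
      show "psd_on I (A x)"
        unfolding psd_on_iff_quad_form
      proof (intro conjI ballI allI sym)
        fix v
        show "0 \<le> quad_form I (A x) v"
          using D[of "case_sum v (\<lambda>_. 0)"] unfolding form by (simp add: o_def)
      qed
      fix k assume "k \<in> K"
      then show "0 \<le> b k x"
        using D[of "case_sum (\<lambda>_. 0) (\<lambda>l. if l = k then 1 else 0)"] K unfolding form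
        by (simp add: o_def quad_form_def if_distrib if_distribR cong: if_cong)
    qed
  qed
  then obtain qs where qs: "\<And>x. \<phi> x = (\<Sum>q\<leftarrow>qs. quad_form ?J (D x) q)" by blast
  show ?thesis
  proof (intro exI[of _ "map (\<lambda>q. q \<circ> Inl) qs"] exI[of _ "\<lambda>k. \<Sum>q\<leftarrow>qs. (q (Inr k))\<^sup>2"] conjI allI)
    show "0 \<le> (\<Sum>q\<leftarrow>qs. (q (Inr k))\<^sup>2)" for k by (intro sum_list_nonneg) auto
    fix x
    have "(\<Sum>q\<leftarrow>qs. \<Sum>k\<in>K. b k x * (q (Inr k))\<^sup>2) = (\<Sum>k\<in>K. (\<Sum>q\<leftarrow>qs. (q (Inr k))\<^sup>2) * b k x)"
      by (induction qs) (auto simp: sum.distrib algebra_simps)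
    then show "\<phi> x = (\<Sum>q\<leftarrow>map (\<lambda>q. q \<circ> Inl) qs. quad_form I (A x) q) +
        (\<Sum>k\<in>K. (\<Sum>q\<leftarrow>qs. (q (Inr k))\<^sup>2) * b k x)"
      unfolding qs form by (simp add: sum_list_addf o_def)
  qed
qed

section \<open>Exponent vectors and polynomials of bounded degree\<close>

lemma lookup_scaleR [simp]:
  "Poly_Mapping.lookup (c *\<^sub>R p) k = c * Poly_Mapping.lookup (p :: 'a \<Rightarrow>\<^sub>0 real) k"
proof -
  have "finite {i. c * Poly_Mapping.lookup p i \<noteq> 0}"
    by (rule finite_subset[OF _ finite_lookup[of p]]) auto
  then show ?thesis by (simp add: scaleR_poly_mapping_def Abs_poly_mapping_inverse)
qed

definition mapping_on :: "'a set \<Rightarrow> ('a \<Rightarrow> real) \<Rightarrow> 'a \<Rightarrow>\<^sub>0 real" where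
  "mapping_on I c = (\<Sum>k\<in>I. Poly_Mapping.single k (c k))"

lemma lookup_mapping_on:
  "finite I \<Longrightarrow> Poly_Mapping.lookup (mapping_on I c) k = (if k \<in> I then c k else 0)"
  by (simp add: mapping_on_def lookup_sum lookup_single when_def)

lemma monom_deg_add [simp]: "monom_deg (\<alpha> + \<beta>) = monom_deg \<alpha> + monom_deg \<beta>"
  by (simp add: monom_deg_def lookup_add sum.distrib)

lemma monom_deg_zero [simp]: "monom_deg 0 = 0"
  by (simp add: monom_deg_def)

lemma monom_deg_single [simp]: "monom_deg (Poly_Mapping.single i k) = k"
  by (simp add: monom_deg_def lookup_single when_def)

lemma lookup_le_monom_deg: "Poly_Mapping.lookup \<alpha> i \<le> monom_deg \<alpha>"
  unfolding monom_deg_def by (intro member_le_sum) auto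

lemma mem_monoms_upto: "\<alpha> \<in> monoms_upto k \<longleftrightarrow> monom_deg \<alpha> \<le> k"
  by (simp add: monoms_upto_def)

lemma finite_monoms_upto [simp]: "finite (monoms_upto k :: ('n::finite) monom set)"
proof (rule finite_imageD)
  show "finite (Poly_Mapping.lookup ` (monoms_upto k :: 'n monom set))"
  proof (rule finite_subset)
    show "Poly_Mapping.lookup ` (monoms_upto k :: 'n monom set) \<subseteq> UNIV \<rightarrow>\<^sub>E {..k}"
      using lookup_le_monom_deg by (fastforce simp: mem_monoms_upto intro: order_trans)
  qed (intro finite_PiE; simp)
  show "inj_on Poly_Mapping.lookup (monoms_upto k :: 'n monom set)"
    by (auto simp: inj_on_def intro: poly_mapping_eqI)
qed

lemma monom_split_variable:
  assumes "monom_deg \<alpha> \<noteq> 0"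
  obtains i \<beta> where "\<alpha> = Poly_Mapping.single i 1 + \<beta>"
proof -
  obtain i where i: "Poly_Mapping.lookup \<alpha> i \<noteq> 0" using assms unfolding monom_deg_def by auto
  have "\<alpha> = Poly_Mapping.single i 1 + (\<alpha> - Poly_Mapping.single i 1)"
    by (rule poly_mapping_eqI) (use i in \<open>auto simp: lookup_add lookup_minus lookup_single when_def\<close>)
  then show ?thesis by (rule that)
qed

lemma monom_split:
  assumes "k \<le> monom_deg \<alpha>"
  obtains \<beta> \<gamma> where "\<alpha> = \<beta> + \<gamma>" "monom_deg \<beta> = k"
proof -
  have "\<exists>\<beta> \<gamma>. \<alpha> = \<beta> + \<gamma> \<and> monom_deg \<beta> = k" using assms
  proof (induction k)
    case 0
    then show ?case by (intro exI[of _ 0] exI[of _ \<alpha>]) simp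
  next
    case (Suc k)
    then obtain \<beta> \<gamma> where s: "\<alpha> = \<beta> + \<gamma>" "monom_deg \<beta> = k" by auto
    with Suc.prems have "monom_deg \<gamma> \<noteq> 0" by simp
    then obtain i \<delta> where "\<gamma> = Poly_Mapping.single i 1 + \<delta>" by (rule monom_split_variable)
    with s have "\<alpha> = (\<beta> + Poly_Mapping.single i 1) + \<delta>" by (simp add: add.assoc)
    moreover have "monom_deg (\<beta> + Poly_Mapping.single i 1) = Suc k" using s by simp
    ultimately show ?case by blast
  qed
  then show ?thesis using that by blast
qed

lemma monom_halve:
  assumes "\<alpha> \<in> monoms_upto (2 * r)"
  obtains \<beta> \<gamma> where "\<alpha> = \<beta> + \<gamma>" "\<beta> \<in> monoms_upto r" "\<gamma> \<in> monoms_upto r"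
proof -
  obtain \<beta> \<gamma> where "\<alpha> = \<beta> + \<gamma>" "monom_deg \<beta> = min r (monom_deg \<alpha>)"
    using monom_split[of "min r (monom_deg \<alpha>)" \<alpha>] by auto
  then show ?thesis using assms that by (auto simp: mem_monoms_upto)
qed

section \<open>Evaluation\<close>

definition monom_val :: "real ^ 'n \<Rightarrow> ('n::finite) monom \<Rightarrow> real" where
  "monom_val x \<alpha> = (\<Prod>i\<in>UNIV. (x $ i) ^ Poly_Mapping.lookup \<alpha> i)"

lemma monom_val_add: "monom_val x (\<alpha> + \<beta>) = monom_val x \<alpha> * monom_val x \<beta>"
  by (simp add: monom_val_def lookup_add power_add prod.distrib)

lemma monom_val_zero [simp]: "monom_val x 0 = 1"
  by (simp add: monom_val_def)

lemma monom_val_single [simp]: "monom_val x (Poly_Mapping.single i k) = (x $ i) ^ k"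
  by (simp add: monom_val_def lookup_single when_def if_distrib cong: if_cong)

lemma poly_eval_eq_sum:
  assumes "p \<in> polys_upto k"
  shows "poly_eval p x = (\<Sum>\<alpha>\<in>monoms_upto k. Poly_Mapping.lookup p \<alpha> * monom_val x \<alpha>)"
  unfolding poly_eval_def monom_val_def using assms
  by (intro sum.mono_neutral_left) (auto simp: polys_upto_def in_keys_iff)

lemma continuous_on_poly_eval: "continuous_on S (poly_eval p)"
  unfolding poly_eval_def by (intro continuous_intros)

lemma polys_upto_iff: "p \<in> polys_upto k \<longleftrightarrow> (\<forall>\<alpha>. k < monom_deg \<alpha> \<longrightarrow> Poly_Mapping.lookup p \<alpha> = 0)"
  by (auto simp: polys_upto_def subset_iff in_keys_iff mem_monoms_upto) (metis not_le)

lemma polys_upto_mono: "p \<in> polys_upto k \<Longrightarrow> k \<le> l \<Longrightarrow> p \<in> polys_upto l"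
  by (simp add: polys_upto_iff)

section \<open>The Riesz functional and the regularizing polynomial\<close>

lemma linear_riesz_moments: "linear (\<lambda>y. riesz r y p)"
  by (intro linearI) (simp_all add: riesz_def lookup_add algebra_simps sum.distrib sum_distrib_left)

lemma linear_riesz: "linear (riesz r y)"
  by (intro linearI) (simp_all add: riesz_def lookup_add algebra_simps sum.distrib sum_distrib_left)

lemma riesz_single:
  "riesz r y (Poly_Mapping.single \<alpha> c) = (if \<alpha> \<in> monoms_upto (2 * r) then c * Poly_Mapping.lookup y \<alpha> else 0)"
  by (simp add: riesz_def lookup_single when_def if_distrib if_distribR cong: if_cong)

lemma riesz_one: "riesz r y 1 = Poly_Mapping.lookup y 0"
  using riesz_single[of r y 0 1] by (simp add: mem_monoms_upto)

lemma riesz_pvar: "1 \<le> r \<Longrightarrow> riesz r y (pvar i) = Poly_Mapping.lookup y (Poly_Mapping.single i 1)"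
  by (simp add: pvar_def riesz_single mem_monoms_upto)

lemma riesz_cong:
  assumes "\<And>\<alpha>. \<alpha> \<in> monoms_upto (2 * r) \<Longrightarrow> Poly_Mapping.lookup y \<alpha> = Poly_Mapping.lookup z \<alpha>"
  shows "riesz r y p = riesz r z p"
  unfolding riesz_def using assms by (intro sum.cong) auto

lemma scaled_variable_power:
  "(c *\<^sub>R pvar j) ^ k = (Poly_Mapping.single (Poly_Mapping.single j k) (c ^ k) :: ('n::finite) rpoly)"
proof -
  have 1: "c *\<^sub>R pvar j = (Poly_Mapping.single (Poly_Mapping.single j 1) c :: 'n rpoly)"
    by (rule poly_mapping_eqI) (simp add: pvar_def lookup_single when_def)
  show ?thesis
  proof (induction k)
    case (Suc k)
    have "(c *\<^sub>R pvar j) ^ Suc k = Poly_Mapping.single (Poly_Mapping.single j 1) c *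
        (Poly_Mapping.single (Poly_Mapping.single j k) (c ^ k) :: 'n rpoly)"
      unfolding power_Suc Suc.IH by (simp only: 1)
    also have "\<dots> = Poly_Mapping.single (Poly_Mapping.single j 1 + Poly_Mapping.single j k) (c * c ^ k)"
      by (rule mult_single)
    also have "Poly_Mapping.single j 1 + Poly_Mapping.single j k = Poly_Mapping.single j (Suc k)"
      by (simp flip: single_add)
    finally show ?case by simp
  qed simp
qed

lemma Theta_eq:
  "Theta L r = (\<Sum>j\<in>UNIV. Poly_Mapping.single (Poly_Mapping.single j (2 * r)) ((1 / L) ^ (2 * r)))"
  unfolding Theta_def scaled_variable_power ..

lemma riesz_one_plus_Theta:
  "riesz r y (1 + Theta L r) = Poly_Mapping.lookup y 0 +
     (\<Sum>j\<in>UNIV. (1 / L) ^ (2 * r) * Poly_Mapping.lookup y (Poly_Mapping.single j (2 * r)))"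
  unfolding Theta_eq linear_add[OF linear_riesz] linear_sum[OF linear_riesz] riesz_one riesz_single
  by (simp add: mem_monoms_upto)

lemma one_plus_Theta_in_polys_upto: "1 + Theta L r \<in> polys_upto (2 * r)"
proof -
  have "Poly_Mapping.lookup (1 + Theta L r) \<alpha> = 0" if "2 * r < monom_deg \<alpha>" for \<alpha> :: "'a monom"
  proof -
    have "\<alpha> \<noteq> 0" "\<And>j. Poly_Mapping.single j (2 * r) \<noteq> \<alpha>" using that by auto
    then show ?thesis
      by (auto simp: Theta_eq lookup_add lookup_one lookup_sum lookup_single when_def)
  qed
  then show ?thesis by (simp add: polys_upto_iff)
qed

section \<open>Sums of squares\<close>

lemma expand_poly:
  assumes "q \<in> polys_upto r"
  shows "q = (\<Sum>\<alpha>\<in>monoms_upto r. Poly_Mapping.single \<alpha> (Poly_Mapping.lookup q \<alpha>))"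
  by (rule poly_mapping_eqI)
    (use assms in \<open>auto simp: lookup_sum lookup_single when_def polys_upto_iff mem_monoms_upto\<close>)

lemma square_expansion:
  assumes "q \<in> polys_upto r"
  shows "q ^ 2 = (\<Sum>\<alpha>\<in>monoms_upto r. \<Sum>\<beta>\<in>monoms_upto r.
    Poly_Mapping.single (\<alpha> + \<beta>) (Poly_Mapping.lookup q \<alpha> * Poly_Mapping.lookup q \<beta>))"
proof -
  have "q ^ 2 = (\<Sum>\<alpha>\<in>monoms_upto r. Poly_Mapping.single \<alpha> (Poly_Mapping.lookup q \<alpha>)) *
      (\<Sum>\<alpha>\<in>monoms_upto r. Poly_Mapping.single \<alpha> (Poly_Mapping.lookup q \<alpha>))"
    using expand_poly[OF assms] by (simp add: power2_eq_square)
  then show ?thesis by (simp add: sum_product mult_single)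
qed

lemma riesz_square:
  assumes "q \<in> polys_upto r"
  shows "riesz r y (q ^ 2) = quad_form (monoms_upto r) (moment_matrix y) (Poly_Mapping.lookup q)"
  unfolding square_expansion[OF assms] linear_sum[OF linear_riesz] riesz_single quad_form_def
    moment_matrix_def
  by (intro sum.cong refl) (auto simp: mem_monoms_upto)

definition monom_norm2 :: "('n::finite) monom \<Rightarrow> nat" where
  "monom_norm2 \<alpha> = (\<Sum>i\<in>UNIV. (Poly_Mapping.lookup \<alpha> i)\<^sup>2)"

text \<open>
  Strict convexity of the squared Euclidean norm on exponent vectors, in the form of the parallelogram
  law. It is what singles out an extreme exponent in a sum of squares, and what makes the moment
  matrix below diagonally dominant.
\<close>
lemma monom_norm2_parallelogram:
  "int (monom_norm2 (\<alpha> + \<beta>)) + (\<Sum>i\<in>UNIV. (int (Poly_Mapping.lookup \<alpha> i) - int (Poly_Mapping.lookup \<beta> i))\<^sup>2)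
    = 2 * int (monom_norm2 \<alpha>) + 2 * int (monom_norm2 \<beta>)"
  unfolding monom_norm2_def by (simp add: lookup_add sum.distrib[symmetric] sum_distrib_left)
    (intro sum.cong refl, simp add: power2_eq_square algebra_simps)

lemma monom_diff_norm_pos:
  assumes "\<alpha> \<noteq> \<beta>"
  shows "1 \<le> (\<Sum>i\<in>UNIV. (int (Poly_Mapping.lookup \<alpha> i) - int (Poly_Mapping.lookup (\<beta> :: ('n::finite) monom) i))\<^sup>2)"
proof -
  obtain i where "Poly_Mapping.lookup \<alpha> i \<noteq> Poly_Mapping.lookup \<beta> i"
    using assms by (auto simp: poly_mapping_eq_iff fun_eq_iff)
  then have "0 < (int (Poly_Mapping.lookup \<alpha> i) - int (Poly_Mapping.lookup \<beta> i))\<^sup>2" by simp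
  then have "0 < (\<Sum>i\<in>UNIV. (int (Poly_Mapping.lookup \<alpha> i) - int (Poly_Mapping.lookup \<beta> i))\<^sup>2)"
    by (intro sum_pos2[of _ i]) auto
  then show ?thesis by linarith
qed

lemma finite_maximizer:
  fixes f :: "'a \<Rightarrow> 'b::linorder"
  assumes "finite S" "S \<noteq> {}"
  obtains a where "a \<in> S" "\<And>b. b \<in> S \<Longrightarrow> f b \<le> f a"
  using obtains_MAX[OF assms, of f] assms(1) by (metis Max_ge finite_imageI imageI)

text \<open>
  Leading terms of squares cannot cancel. Among the exponents of maximal degree that occur in some
  summand, take one, \<open>\<alpha>\<close>, of maximal Euclidean norm. By strict convexity \<open>\<alpha> + \<alpha>\<close> is a sum of two
  occurring exponents in only one way, so its coefficient in the sum of squares is the sum of the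
  squares of the coefficients at \<open>\<alpha>\<close>, which is positive.
\<close>
lemma sos_summands_degree:
  fixes qs :: "('n::finite) rpoly list"
  assumes sos: "(\<Sum>q\<leftarrow>qs. q ^ 2) \<in> polys_upto (2 * r)" and q: "q \<in> set qs"
  shows "q \<in> polys_upto r"
proof (rule ccontr)
  assume nq: "q \<notin> polys_upto r"
  define S where "S = (\<Union>q\<in>set qs. Poly_Mapping.keys q)"
  have S: "finite S" by (simp add: S_def)
  obtain \<delta> where \<delta>: "\<delta> \<in> S" "r < monom_deg \<delta>"
    using q nq by (auto simp: S_def polys_upto_iff in_keys_iff)
  define D where "D = Max (monom_deg ` S)"
  have D: "\<And>\<alpha>. \<alpha> \<in> S \<Longrightarrow> monom_deg \<alpha> \<le> D" "D \<in> monom_deg ` S" "r < D"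
    using S \<delta> by (auto simp: D_def Max_ge_iff less_le_trans[OF \<delta>(2)] intro!: Max_in)
  define T where "T = {\<alpha> \<in> S. monom_deg \<alpha> = D}"
  have T: "finite T" "T \<noteq> {}" using S D(2) by (auto simp: T_def)
  obtain \<alpha> where \<alpha>: "\<alpha> \<in> T" "\<And>\<beta>. \<beta> \<in> T \<Longrightarrow> monom_norm2 \<beta> \<le> monom_norm2 \<alpha>"
    using finite_maximizer[OF T, of monom_norm2] by blast
  have only: "\<beta> = \<alpha> \<and> \<gamma> = \<alpha>" if bg: "\<beta> \<in> S" "\<gamma> \<in> S" "\<beta> + \<gamma> = \<alpha> + \<alpha>" for \<beta> \<gamma>
  proof -
    have "monom_deg \<beta> + monom_deg \<gamma> = 2 * D"
      using arg_cong[OF bg(3), of monom_deg] \<alpha>(1) by (simp add: T_def)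
    then have "\<beta> \<in> T" "\<gamma> \<in> T" using D(1)[OF bg(1)] D(1)[OF bg(2)] bg by (auto simp: T_def)
    then have "monom_norm2 \<beta> \<le> monom_norm2 \<alpha>" "monom_norm2 \<gamma> \<le> monom_norm2 \<alpha>" using \<alpha>(2) by auto
    moreover have "int (monom_norm2 (\<alpha> + \<alpha>)) = 4 * int (monom_norm2 \<alpha>)"
      using monom_norm2_parallelogram[of \<alpha> \<alpha>] by simp
    ultimately have "\<beta> = \<gamma>"
      using monom_norm2_parallelogram[of \<beta> \<gamma>] monom_diff_norm_pos[of \<beta> \<gamma>] bg(3) by force
    moreover have "\<beta> = \<alpha>" if "\<beta> = \<gamma>"
    proof (rule poly_mapping_eqI)
      fix i show "Poly_Mapping.lookup \<beta> i = Poly_Mapping.lookup \<alpha> i"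
        using arg_cong[OF bg(3), of "\<lambda>m. Poly_Mapping.lookup m i"] that by (simp add: lookup_add)
    qed
    ultimately show ?thesis by simp
  qed
  have coeff: "Poly_Mapping.lookup (p ^ 2) (\<alpha> + \<alpha>) = (Poly_Mapping.lookup p \<alpha>)\<^sup>2" if p: "p \<in> set qs" for p
  proof -
    have k: "Poly_Mapping.keys p \<subseteq> S" using p by (auto simp: S_def)
    then have pD: "p \<in> polys_upto D" using D(1) by (auto simp: polys_upto_def mem_monoms_upto)
    have "Poly_Mapping.lookup (p ^ 2) (\<alpha> + \<alpha>) = (\<Sum>\<beta>\<in>monoms_upto D. \<Sum>\<gamma>\<in>monoms_upto D.
        if \<beta> + \<gamma> = \<alpha> + \<alpha> then Poly_Mapping.lookup p \<beta> * Poly_Mapping.lookup p \<gamma> else 0)"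
      by (simp add: square_expansion[OF pD] lookup_sum lookup_single when_def)
    also have "\<dots> = (\<Sum>\<beta>\<in>monoms_upto D. \<Sum>\<gamma>\<in>monoms_upto D.
        if \<gamma> = \<alpha> then if \<beta> = \<alpha> then Poly_Mapping.lookup p \<beta> * Poly_Mapping.lookup p \<gamma> else 0 else 0)"
    proof (intro sum.cong refl)
      fix \<beta> \<gamma>
      have "Poly_Mapping.lookup p \<beta> * Poly_Mapping.lookup p \<gamma> = 0" if "\<beta> \<notin> S \<or> \<gamma> \<notin> S"
        using that k by (metis in_keys_iff mult_eq_0_iff subsetD)
      then show "(if \<beta> + \<gamma> = \<alpha> + \<alpha> then Poly_Mapping.lookup p \<beta> * Poly_Mapping.lookup p \<gamma> else 0) =
        (if \<gamma> = \<alpha> then if \<beta> = \<alpha> then Poly_Mapping.lookup p \<beta> * Poly_Mapping.lookup p \<gamma> else 0 else 0)"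
        using only[of \<beta> \<gamma>] by auto
    qed
    also have "\<dots> = (Poly_Mapping.lookup p \<alpha>)\<^sup>2"
      using \<alpha>(1) by (simp add: T_def mem_monoms_upto power2_eq_square)
    finally show ?thesis .
  qed
  have "Poly_Mapping.lookup (\<Sum>q\<leftarrow>ps. q ^ 2) (\<alpha> + \<alpha>) = (\<Sum>p\<leftarrow>ps. (Poly_Mapping.lookup p \<alpha>)\<^sup>2)"
    if "set ps \<subseteq> set qs" for ps
    using that by (induction ps) (auto simp: lookup_add coeff)
  then have "(\<Sum>p\<leftarrow>qs. (Poly_Mapping.lookup p \<alpha>)\<^sup>2) = Poly_Mapping.lookup (\<Sum>q\<leftarrow>qs. q ^ 2) (\<alpha> + \<alpha>)"
    by simp
  also have "\<dots> = 0"
    using sos \<alpha>(1) D(3) by (simp add: polys_upto_iff T_def)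
  finally have "\<forall>p\<in>set qs. (Poly_Mapping.lookup p \<alpha>)\<^sup>2 = 0"
    by (subst (asm) sum_list_nonneg_eq_0_iff) auto
  moreover obtain p where "p \<in> set qs" "Poly_Mapping.lookup p \<alpha> \<noteq> 0"
    using \<alpha>(1) by (auto simp: T_def S_def in_keys_iff)
  ultimately show False by auto
qed

lemma riesz_sos_nonneg:
  assumes "p \<in> sos_upto (2 * r)" "psd_on (monoms_upto r) (moment_matrix y)"
  shows "0 \<le> riesz r y p"
proof -
  obtain qs where qs: "p = (\<Sum>q\<leftarrow>qs. q ^ 2)" and p: "p \<in> polys_upto (2 * r)"
    using assms(1) by (auto simp: sos_upto_def)
  have "0 \<le> riesz r y (q ^ 2)" if "q \<in> set qs" for q
    using sos_summands_degree[OF p[unfolded qs] that] assms(2)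
    by (simp add: riesz_square psd_on_iff_quad_form)
  moreover have "riesz r y (\<Sum>q\<leftarrow>ps. q ^ 2) = (\<Sum>q\<leftarrow>ps. riesz r y (q ^ 2))" for ps
    by (induction ps) (auto simp: linear_add[OF linear_riesz] linear_0[OF linear_riesz])
  ultimately show ?thesis unfolding qs by (auto intro!: sum_list_nonneg)
qed

section \<open>Moment vectors are controlled by their extreme entries\<close>

text \<open>
  Nonnegativity of \<open>L\<^sub>y\<close> on the squares \<open>(x\<^sup>\<alpha> \<plusminus> x\<^sup>\<beta>)\<^sup>2\<close>.
\<close>
lemma moment_offdiagonal_bound:
  assumes psd: "psd_on (monoms_upto r) (moment_matrix y)"
    and ab: "\<alpha> \<in> monoms_upto r" "\<beta> \<in> monoms_upto r"
  shows "2 * \<bar>Poly_Mapping.lookup y (\<alpha> + \<beta>)\<bar> \<le> Poly_Mapping.lookup y (\<alpha> + \<alpha>) + Poly_Mapping.lookup y (\<beta> + \<beta>)"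
proof -
  have pos: "0 \<le> Poly_Mapping.lookup y (\<alpha> + \<alpha>) + 2 * c * Poly_Mapping.lookup y (\<alpha> + \<beta>) + c\<^sup>2 * Poly_Mapping.lookup y (\<beta> + \<beta>)" for c
  proof -
    let ?q = "Poly_Mapping.single \<alpha> 1 + Poly_Mapping.single \<beta> c"
    have "?q \<in> polys_upto r" using ab
      by (auto simp: polys_upto_iff lookup_add lookup_single when_def mem_monoms_upto)
    then have "0 \<le> riesz r y (?q ^ 2)" using psd by (simp add: riesz_square psd_on_iff_quad_form)
    also have "?q ^ 2 = Poly_Mapping.single (\<alpha> + \<alpha>) 1 +
        (Poly_Mapping.single (\<alpha> + \<beta>) c + Poly_Mapping.single (\<alpha> + \<beta>) c) + Poly_Mapping.single (\<beta> + \<beta>) (c\<^sup>2)"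
      by (simp add: power2_eq_square algebra_simps mult_single)
    finally show ?thesis
      using ab unfolding linear_add[OF linear_riesz] by (simp add: riesz_single mem_monoms_upto)
  qed
  show ?thesis using pos[of 1] pos[of "-1"] by simp
qed

text \<open>
  A maximum principle for the diagonal entries \<open>y\<^sub>2\<^sub>\<beta>\<close>. If \<open>\<beta>\<close> is a maximizer and \<open>2 \<beta> = \<alpha> + \<gamma>\<close>, then
  \<open>2 y\<^sub>2\<^sub>\<beta> \<le> y\<^sub>2\<^sub>\<alpha> + y\<^sub>2\<^sub>\<gamma>\<close> forces \<open>\<gamma>\<close> to be a maximizer too. Moving along such splittings reaches
  \<open>0\<close> when \<open>2 \<beta>\<close> has degree at most \<open>r\<close>. Otherwise it reaches degree exactly \<open>r\<close>, and from there
  each positive exponent of a variable can be increased until it equals \<open>r\<close>.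
\<close>
lemma moment_diagonal_bound:
  fixes y :: "('n::finite) monom \<Rightarrow>\<^sub>0 real"
  assumes psd: "psd_on (monoms_upto r) (moment_matrix y)" and b: "\<beta> \<in> monoms_upto r"
  obtains "Poly_Mapping.lookup y (\<beta> + \<beta>) \<le> Poly_Mapping.lookup y 0"
  | j where "Poly_Mapping.lookup y (\<beta> + \<beta>) \<le> Poly_Mapping.lookup y (Poly_Mapping.single j (2 * r))"
proof -
  let ?I = "monoms_upto r :: 'n monom set"
  define d where "d \<beta> = Poly_Mapping.lookup y (\<beta> + \<beta>)" for \<beta>
  define X where "X = {\<beta> \<in> ?I. \<forall>\<gamma>\<in>?I. d \<gamma> \<le> d \<beta>}"
  have "finite ?I" "?I \<noteq> {}" using b by auto
  then obtain \<delta> where "\<delta> \<in> ?I" "\<And>\<gamma>. \<gamma> \<in> ?I \<Longrightarrow> d \<gamma> \<le> d \<delta>"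
    using finite_maximizer[of ?I d] by blast
  then have \<delta>: "\<delta> \<in> X" by (simp add: X_def)
  have move: "\<gamma> \<in> X" if "\<beta> \<in> X" "\<beta> + \<beta> = \<alpha> + \<gamma>" "\<alpha> \<in> ?I" "\<gamma> \<in> ?I" for \<alpha> \<beta> \<gamma>
  proof -
    have "2 * \<bar>d \<beta>\<bar> \<le> d \<alpha> + d \<gamma>"
      using moment_offdiagonal_bound[OF psd that(3,4)] that(2) by (simp add: d_def)
    moreover have "d \<alpha> \<le> d \<beta>" using that by (auto simp: X_def)
    ultimately have "d \<beta> \<le> d \<gamma>" by linarith
    then show ?thesis using that by (force simp: X_def)
  qed
  have "0 \<in> X \<or> (\<exists>j. Poly_Mapping.single j r \<in> X)"
  proof (cases "2 * monom_deg \<delta> \<le> r \<or> r = 0")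
    case True
    have "0 \<in> X"
    proof (cases "r = 0")
      case True
      have "\<delta> = 0" 
      proof (rule poly_mapping_eqI)
        fix i show "Poly_Mapping.lookup \<delta> i = Poly_Mapping.lookup 0 i"
          using lookup_le_monom_deg[of \<delta> i] \<delta> True by (simp add: X_def mem_monoms_upto)
      qed
      with \<delta> show ?thesis by simp
    next
      case False
      with True show ?thesis by (intro move[OF \<delta>, of "\<delta> + \<delta>"]) (auto simp: mem_monoms_upto)
    qed
    then show ?thesis ..
  next
    case False
    define Y where "Y = {\<beta> \<in> X. monom_deg \<beta> = r}"
    obtain \<alpha> \<gamma> where s: "\<delta> + \<delta> = \<alpha> + \<gamma>" "monom_deg \<alpha> = r"
      using monom_split[of r "\<delta> + \<delta>"] False by auto
    have "2 * monom_deg \<delta> = monom_deg \<alpha> + monom_deg \<gamma>"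
      using arg_cong[OF s(1), of monom_deg] by simp
    then have "monom_deg \<gamma> \<le> r" using \<delta> s(2) by (simp add: X_def mem_monoms_upto)
    with s have "\<alpha> \<in> Y" unfolding Y_def using move[OF \<delta>, of \<gamma> \<alpha>]
      by (auto simp: mem_monoms_upto add.commute)
    moreover from s(2) False have "(\<Sum>i\<in>UNIV. Poly_Mapping.lookup \<alpha> i) \<noteq> 0"
      by (simp flip: monom_deg_def)
    then obtain j where "Poly_Mapping.lookup \<alpha> j \<noteq> 0"
      using sum.not_neutral_contains_not_neutral by blast
    ultimately have ne: "\<alpha> \<in> {\<beta>\<in>Y. 0 < Poly_Mapping.lookup \<beta> j}" (is "_ \<in> ?Z") by simp
    have "finite ?Z" by (rule finite_subset[of _ ?I]) (auto simp: Y_def X_def)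
    then obtain \<beta> where \<beta>: "\<beta> \<in> ?Z"
      "\<And>\<gamma>. \<gamma> \<in> ?Z \<Longrightarrow> Poly_Mapping.lookup \<gamma> j \<le> Poly_Mapping.lookup \<beta> j"
      using finite_maximizer[of ?Z "\<lambda>\<beta>. Poly_Mapping.lookup \<beta> j"] ne by blast
    let ?k = "Poly_Mapping.lookup \<beta> j"
    have "?k = r"
    proof (rule ccontr)
      assume "?k \<noteq> r"
      then have k: "0 < ?k" "?k < r" using lookup_le_monom_deg[of \<beta> j] \<beta>(1) by (auto simp: Y_def)
      define \<rho> where "\<rho> = \<beta> + \<beta> - Poly_Mapping.single j (Suc ?k)"
      have \<rho>: "\<beta> + \<beta> = Poly_Mapping.single j (Suc ?k) + \<rho>"
        by (rule poly_mapping_eqI)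
          (use k in \<open>auto simp: \<rho>_def lookup_add lookup_minus lookup_single when_def\<close>)
      have deg: "Suc ?k + monom_deg \<rho> = 2 * r"
        using arg_cong[OF \<rho>, of monom_deg] \<beta>(1) by (simp add: Y_def)
      have "r - Suc ?k \<le> monom_deg \<rho>" using deg k by linarith
      then obtain \<mu> \<nu> where mn: "\<rho> = \<mu> + \<nu>" "monom_deg \<mu> = r - Suc ?k"
        using monom_split by blast
      let ?\<gamma> = "Poly_Mapping.single j (Suc ?k) + \<mu>"
      have "monom_deg \<nu> = r" "monom_deg ?\<gamma> = r" using mn deg k by auto
      moreover have "\<beta> + \<beta> = \<nu> + ?\<gamma>" using \<rho> mn by (simp add: add_ac)
      ultimately have "?\<gamma> \<in> ?Z" using move[of \<beta> \<nu> ?\<gamma>] \<beta>(1)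
        by (auto simp: Y_def mem_monoms_upto lookup_add)
      from \<beta>(2)[OF this] show False by (simp add: lookup_add)
    qed
    have "\<beta> = Poly_Mapping.single j r"
    proof (rule poly_mapping_eqI)
      fix i
      have "(\<Sum>i\<in>UNIV. Poly_Mapping.lookup \<beta> i) = ?k + (\<Sum>i\<in>UNIV-{j}. Poly_Mapping.lookup \<beta> i)"
        by (simp add: sum.remove)
      with \<beta>(1) \<open>?k = r\<close> have "(\<Sum>i\<in>UNIV-{j}. Poly_Mapping.lookup \<beta> i) = 0"
        by (simp add: Y_def monom_deg_def)
      then show "Poly_Mapping.lookup \<beta> i = Poly_Mapping.lookup (Poly_Mapping.single j r) i"
        using \<open>?k = r\<close> by (auto simp: lookup_single when_def)
    qed
    with \<beta>(1) show ?thesis by (auto simp: Y_def)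
  qed
  then show thesis
  proof
    assume "0 \<in> X"
    then have "d \<beta> \<le> d 0" using b by (auto simp: X_def)
    then show thesis by (intro that(1)) (simp add: d_def)
  next
    assume "\<exists>j. Poly_Mapping.single j r \<in> X"
    then obtain j where "Poly_Mapping.single j r \<in> X" ..
    then have "d \<beta> \<le> d (Poly_Mapping.single j r)" using b by (auto simp: X_def)
    then show thesis by (intro that(2)[of j]) (simp add: d_def mult_2 flip: single_add)
  qed
qed

text \<open>
  The extreme entries \<open>y\<^sub>0\<close> and \<open>L\<^sub>y(x\<^sub>j\<^sup>2\<^sup>r)\<close> are nonnegative and add up, with weights \<open>1\<close> and
  \<open>L\<^sup>-\<^sup>2\<^sup>r\<close>, to \<open>L\<^sub>y(1 + \<Theta>)\<close>. They dominate the diagonal, and the diagonal dominates each entry.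
\<close>
lemma moment_bound:
  assumes psd: "psd_on (monoms_upto r) (moment_matrix y)" and L: "0 < L"
    and a: "\<alpha> \<in> monoms_upto (2 * r)"
  shows "\<bar>Poly_Mapping.lookup y \<alpha>\<bar> \<le> (1 + L ^ (2 * r)) * riesz r y (1 + Theta L r)"
proof -
  let ?R = "riesz r y (1 + Theta L r)" and ?B = "1 + L ^ (2 * r)"
  have diag: "0 \<le> Poly_Mapping.lookup y (\<beta> + \<beta>)" if "\<beta> \<in> monoms_upto r" for \<beta>
    using moment_offdiagonal_bound[OF psd that that] by linarith
  have y0: "0 \<le> Poly_Mapping.lookup y 0" using diag[of 0] by (simp add: mem_monoms_upto)
  have yj: "0 \<le> Poly_Mapping.lookup y (Poly_Mapping.single j (2 * r))" for j
    using diag[of "Poly_Mapping.single j r"] by (simp add: mem_monoms_upto mult_2 flip: single_add)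
  have R0: "Poly_Mapping.lookup y 0 \<le> ?R"
    unfolding riesz_one_plus_Theta using yj L by (simp add: sum_nonneg)
  have Rj: "(1 / L) ^ (2 * r) * Poly_Mapping.lookup y (Poly_Mapping.single j (2 * r)) \<le> ?R" for j
  proof -
    have "(1 / L) ^ (2 * r) * Poly_Mapping.lookup y (Poly_Mapping.single j (2 * r))
      \<le> (\<Sum>j\<in>UNIV. (1 / L) ^ (2 * r) * Poly_Mapping.lookup y (Poly_Mapping.single j (2 * r)))"
      using yj L by (intro member_le_sum) auto
    then show ?thesis unfolding riesz_one_plus_Theta using y0 by linarith
  qed
  have Rnn: "0 \<le> ?R" using R0 y0 by linarith
  have B: "Poly_Mapping.lookup y (\<beta> + \<beta>) \<le> ?B * ?R" if "\<beta> \<in> monoms_upto r" for \<beta>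
  proof (rule moment_diagonal_bound[OF psd that])
    assume "Poly_Mapping.lookup y (\<beta> + \<beta>) \<le> Poly_Mapping.lookup y 0"
    also note R0
    also have "?R \<le> ?B * ?R" using Rnn L by (simp add: algebra_simps)
    finally show ?thesis .
  next
    fix j assume "Poly_Mapping.lookup y (\<beta> + \<beta>) \<le> Poly_Mapping.lookup y (Poly_Mapping.single j (2 * r))"
    also have "\<dots> \<le> L ^ (2 * r) * ?R"
      using mult_left_mono[OF Rj[of j], of "L ^ (2 * r)"] L by (simp add: power_one_over field_simps)
    also have "\<dots> \<le> ?B * ?R" using Rnn by (simp add: algebra_simps)
    finally show ?thesis .
  qed
  obtain \<beta> \<gamma> where "\<alpha> = \<beta> + \<gamma>" "\<beta> \<in> monoms_upto r" "\<gamma> \<in> monoms_upto r"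
    using monom_halve[OF a] .
  then show ?thesis using moment_offdiagonal_bound[OF psd, of \<beta> \<gamma>] B[of \<beta>] B[of \<gamma>] by force
qed

lemma keys_mapping_on: "finite I \<Longrightarrow> Poly_Mapping.keys (mapping_on I c) \<subseteq> I"
  by (auto simp: in_keys_iff lookup_mapping_on split: if_splits)

lemma polys_upto_zero: "0 \<in> polys_upto k"
  by (simp add: polys_upto_iff)

lemma polys_upto_add: "p \<in> polys_upto k \<Longrightarrow> q \<in> polys_upto k \<Longrightarrow> p + q \<in> polys_upto k"
  by (simp add: polys_upto_iff lookup_add)

lemma polys_upto_diff: "p \<in> polys_upto k \<Longrightarrow> q \<in> polys_upto k \<Longrightarrow> p - q \<in> polys_upto k"
  by (simp add: polys_upto_iff lookup_minus)

lemma polys_upto_scaleR: "p \<in> polys_upto k \<Longrightarrow> c *\<^sub>R p \<in> polys_upto k"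
  by (simp add: polys_upto_iff)

lemma polys_upto_sum: "(\<And>i. i \<in> S \<Longrightarrow> p i \<in> polys_upto k) \<Longrightarrow> (\<Sum>i\<in>S. p i) \<in> polys_upto k"
  by (simp add: polys_upto_iff lookup_sum)

lemma polys_upto_sum_list: "(\<And>q. q \<in> set qs \<Longrightarrow> p q \<in> polys_upto k) \<Longrightarrow> (\<Sum>q\<leftarrow>qs. p q) \<in> polys_upto k"
  by (induction qs) (simp_all add: polys_upto_zero polys_upto_add)

lemma polys_upto_square:
  assumes "q \<in> polys_upto r"
  shows "q ^ 2 \<in> polys_upto (2 * r)"
  unfolding square_expansion[OF assms]
  by (intro polys_upto_sum)
    (auto simp: polys_upto_iff lookup_single when_def mem_monoms_upto)

lemma poly_eq_if_riesz_eq: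
  assumes "p \<in> polys_upto (2 * r)" "q \<in> polys_upto (2 * r)" "\<And>y. riesz r y p = riesz r y q"
  shows "p = q"
proof (rule poly_mapping_eqI)
  fix \<alpha>
  show "Poly_Mapping.lookup p \<alpha> = Poly_Mapping.lookup q \<alpha>"
  proof (cases "\<alpha> \<in> monoms_upto (2 * r)")
    case True
    then have "riesz r (Poly_Mapping.single \<alpha> 1) s = Poly_Mapping.lookup s \<alpha>" for s
      by (simp add: riesz_def lookup_single when_def if_distrib cong: if_cong)
    with assms(3) show ?thesis by metis
  qed (use assms(1,2) in \<open>simp add: polys_upto_iff mem_monoms_upto\<close>)
qed

section \<open>Moments of a point\<close>

definition point_moments :: "nat \<Rightarrow> real ^ 'n \<Rightarrow> ('n::finite) monom \<Rightarrow>\<^sub>0 real" where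
  "point_moments r x = mapping_on (monoms_upto (2 * r)) (monom_val x)"

lemma riesz_point_moments:
  "p \<in> polys_upto (2 * r) \<Longrightarrow> riesz r (point_moments r x) p = poly_eval p x"
  by (simp add: riesz_def point_moments_def lookup_mapping_on poly_eval_eq_sum)

lemma quad_form_point_moments:
  "quad_form (monoms_upto r) (moment_matrix (point_moments r x)) v = (\<Sum>\<alpha>\<in>monoms_upto r. monom_val x \<alpha> * v \<alpha>)\<^sup>2"
  unfolding quad_form_rank_one[symmetric]
  by (intro quad_form_cong)
    (auto simp: moment_matrix_def point_moments_def lookup_mapping_on mem_monoms_upto monom_val_add)

lemma moment_matrix_commute: "moment_matrix y \<alpha> \<beta> = moment_matrix y \<beta> \<alpha>"
  by (simp add: moment_matrix_def add.commute)

lemma moment_matrix_add: "moment_matrix (y + z) \<alpha> \<beta> = moment_matrix y \<alpha> \<beta> + moment_matrix z \<alpha> \<beta>"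
  by (simp add: moment_matrix_def lookup_add)

lemma moment_matrix_scaleR: "moment_matrix (c *\<^sub>R y) \<alpha> \<beta> = c * moment_matrix y \<alpha> \<beta>"
  by (simp add: moment_matrix_def)

lemma psd_on_moment_matrix_iff:
  "psd_on I (moment_matrix y) \<longleftrightarrow> (\<forall>v. 0 \<le> quad_form I (moment_matrix y) v)"
  using moment_matrix_commute by (auto simp: psd_on_iff_quad_form)

lemma point_moments_Theta_le:
  fixes x :: "real ^ 'n"
  assumes "1 \<le> r" "norm x \<le> L" "0 < L"
  shows "riesz r (point_moments r x) (1 + Theta L r) \<le> 2"
proof -
  have 1: "(1 / L) ^ (2 * r) * (x $ j) ^ (2 * r) \<le> (x $ j / L)\<^sup>2" for j
  proof -
    have "\<bar>x $ j\<bar> \<le> L" using component_le_norm_cart[of x j] assms(2) by linarith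
    then have "(x $ j)\<^sup>2 \<le> L\<^sup>2" using assms(3) by (metis abs_le_square_iff abs_of_pos)
    then have le1: "(x $ j / L)\<^sup>2 \<le> 1" using assms(3) by (simp add: power_divide)
    have "(1 / L) ^ (2 * r) * (x $ j) ^ (2 * r) = ((x $ j / L)\<^sup>2) ^ r"
      by (simp add: power_mult[symmetric] power_divide)
    also have "\<dots> \<le> ((x $ j / L)\<^sup>2) ^ 1"
      using le1 assms(1) by (intro power_decreasing) auto
    finally show ?thesis by simp
  qed
  have "riesz r (point_moments r x) (1 + Theta L r) = 1 + (\<Sum>j\<in>UNIV. (1 / L) ^ (2 * r) * (x $ j) ^ (2 * r))"
    unfolding riesz_one_plus_Theta by (simp add: point_moments_def lookup_mapping_on mem_monoms_upto)
  also have "\<dots> \<le> 1 + (\<Sum>j\<in>UNIV. (x $ j / L)\<^sup>2)"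
    using 1 by (intro add_left_mono sum_mono) auto
  also have "(\<Sum>j\<in>UNIV. (x $ j / L)\<^sup>2) = (norm x)\<^sup>2 / L\<^sup>2"
    by (simp add: power_divide norm_vec_def L2_set_def sum_nonneg flip: sum_divide_distrib)
  also have "\<dots> \<le> 1" using assms(2,3) by (simp add: power_mono)
  finally show ?thesis by simp
qed

section \<open>A positive definite moment matrix\<close>

text \<open>
  With \<open>R = exp (\<sigma>\<^sup>2 / 2)\<close>, these are the moments of independent lognormal variables with parameters
  \<open>0\<close> and \<open>\<sigma>\<^sup>2\<close>.
\<close>
definition lognormal_moments :: "nat \<Rightarrow> real \<Rightarrow> ('n::finite) monom \<Rightarrow>\<^sub>0 real" where
  "lognormal_moments r R = mapping_on (monoms_upto (2 * r)) (\<lambda>\<alpha>. R ^ monom_norm2 \<alpha>)"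

lemma monom_norm2_add_less:
  assumes "\<alpha> \<noteq> \<beta>"
  shows "Suc (monom_norm2 (\<alpha> + \<beta>)) \<le> 2 * monom_norm2 \<alpha> + 2 * monom_norm2 \<beta>"
  using monom_norm2_parallelogram[of \<alpha> \<beta>] monom_diff_norm_pos[OF assms] by linarith

lemma monom_norm2_double: "monom_norm2 (\<alpha> + \<alpha>) = 4 * monom_norm2 \<alpha>"
  using monom_norm2_parallelogram[of \<alpha> \<alpha>] by simp

text \<open>
  After the diagonal rescaling by \<open>R\<close> to the power \<open>2 |\<alpha>|\<^sup>2\<close>, the entry at \<open>(\<alpha>, \<beta>)\<close> becomes \<open>R\<close> to the
  power \<open>- |\<alpha> - \<beta>|\<^sup>2\<close>: it is \<open>1\<close> on the diagonal and at most \<open>1 / R\<close> elsewhere. For \<open>R\<close> twice the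
  size of the matrix, diagonal dominance leaves the lower bound \<open>1 / 2\<close>.
\<close>
lemma lognormal_moment_matrix_pos:
  fixes v :: "('n::finite) monom \<Rightarrow> real" and r :: nat
  defines "R \<equiv> 2 * real (card (monoms_upto r :: 'n monom set))"
  shows "1 / 2 * (\<Sum>\<alpha>\<in>monoms_upto r. (v \<alpha>)\<^sup>2) \<le>
    quad_form (monoms_upto r) (moment_matrix (lognormal_moments r R)) v"
proof -
  let ?I = "monoms_upto r :: 'n monom set"
  let ?N = "real (card ?I)"
  have "0 \<in> ?I" by (simp add: mem_monoms_upto)
  then have "0 < card ?I" by (metis card_gt_0_iff empty_iff finite_monoms_upto)
  then have R: "2 \<le> R" "?N / R = 1 / 2" unfolding R_def by (auto simp: field_simps)
  define w where "w \<alpha> = v \<alpha> * R ^ (2 * monom_norm2 \<alpha>)" for \<alpha>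
  have entry: "(if \<beta> = \<alpha> then (w \<alpha>)\<^sup>2 else 0) - ((w \<alpha>)\<^sup>2 + (w \<beta>)\<^sup>2) / (2 * R)
      \<le> v \<alpha> * R ^ monom_norm2 (\<alpha> + \<beta>) * v \<beta>" for \<alpha> \<beta>
  proof (cases "\<beta> = \<alpha>")
    case True
    have "v \<alpha> * R ^ monom_norm2 (\<alpha> + \<alpha>) * v \<alpha> = (w \<alpha>)\<^sup>2"
      by (simp add: w_def monom_norm2_double power_mult_distrib power2_eq_square flip: power_add)
    then show ?thesis using True R by simp
  next
    case False
    have "R ^ monom_norm2 (\<alpha> + \<beta>) * R \<le> R ^ (2 * monom_norm2 \<alpha> + 2 * monom_norm2 \<beta>)"
      using power_increasing[OF monom_norm2_add_less, of \<alpha> \<beta> R] False R by (simp add: mult.commute)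
    from mult_left_mono[OF this, of "\<bar>v \<alpha>\<bar> * \<bar>v \<beta>\<bar>"]
    have "\<bar>v \<alpha> * R ^ monom_norm2 (\<alpha> + \<beta>) * v \<beta>\<bar> * R \<le> \<bar>w \<alpha>\<bar> * \<bar>w \<beta>\<bar>"
      using R by (simp add: w_def abs_mult power_add mult_ac)
    also have "\<dots> \<le> ((w \<alpha>)\<^sup>2 + (w \<beta>)\<^sup>2) / 2"
      using sum_squares_bound[of "\<bar>w \<alpha>\<bar>" "\<bar>w \<beta>\<bar>"] by simp
    finally have "\<bar>v \<alpha> * R ^ monom_norm2 (\<alpha> + \<beta>) * v \<beta>\<bar> \<le> ((w \<alpha>)\<^sup>2 + (w \<beta>)\<^sup>2) / (2 * R)"
      using R by (simp add: field_simps)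
    then show ?thesis using False by simp
  qed
  have "(\<Sum>\<alpha>\<in>?I. (v \<alpha>)\<^sup>2) \<le> (\<Sum>\<alpha>\<in>?I. (w \<alpha>)\<^sup>2)"
  proof (intro sum_mono)
    fix \<alpha>
    have "(v \<alpha>)\<^sup>2 * 1 \<le> (v \<alpha>)\<^sup>2 * (R ^ (2 * monom_norm2 \<alpha>))\<^sup>2"
      using R by (intro mult_left_mono one_le_power) auto
    then show "(v \<alpha>)\<^sup>2 \<le> (w \<alpha>)\<^sup>2" by (simp add: w_def power_mult_distrib)
  qed
  then have "1 / 2 * (\<Sum>\<alpha>\<in>?I. (v \<alpha>)\<^sup>2) \<le> 1 / 2 * (\<Sum>\<alpha>\<in>?I. (w \<alpha>)\<^sup>2)" by simp
  also have "\<dots> = (\<Sum>\<alpha>\<in>?I. (w \<alpha>)\<^sup>2) - ?N / R * (\<Sum>\<alpha>\<in>?I. (w \<alpha>)\<^sup>2)"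
    unfolding R(2) by simp
  also have "\<dots> = (\<Sum>\<alpha>\<in>?I. \<Sum>\<beta>\<in>?I. (if \<beta> = \<alpha> then (w \<alpha>)\<^sup>2 else 0) - ((w \<alpha>)\<^sup>2 + (w \<beta>)\<^sup>2) / (2 * R))"
    using R by (simp add: sum_subtractf sum.distrib add_divide_distrib flip: sum_divide_distrib sum_distrib_left)
  also have "\<dots> \<le> (\<Sum>\<alpha>\<in>?I. \<Sum>\<beta>\<in>?I. v \<alpha> * R ^ monom_norm2 (\<alpha> + \<beta>) * v \<beta>)"
    using entry by (intro sum_mono)
  also have "\<dots> = quad_form ?I (moment_matrix (lognormal_moments r R)) v"
    unfolding quad_form_def
    by (intro sum.cong) (auto simp: moment_matrix_def lognormal_moments_def lookup_mapping_on mem_monoms_upto)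
  finally show ?thesis .
qed

lemma strict_inequalities_perturb:
  fixes a c :: "'k \<Rightarrow> real"
  assumes "finite K" "\<And>k. k \<in> K \<Longrightarrow> 0 < a k"
  obtains \<epsilon> where "0 < \<epsilon>" "\<And>k. k \<in> K \<Longrightarrow> 0 < a k + \<epsilon> * c k"
proof -
  have "\<forall>\<^sub>F \<epsilon> in at_right 0. 0 < a k + \<epsilon> * c k" if "k \<in> K" for k
  proof -
    have "((\<lambda>\<epsilon>. a k + \<epsilon> * c k) \<longlongrightarrow> a k + 0 * c k) (at_right 0)"
      by (intro tendsto_intros)
    then show ?thesis using assms(2)[OF that] by (intro order_tendstoD(1)) auto
  qed
  then have "\<forall>\<^sub>F \<epsilon> in at_right (0::real). \<forall>k\<in>K. 0 < a k + \<epsilon> * c k"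
    using assms(1) by (simp add: eventually_ball_finite)
  then have "\<forall>\<^sub>F \<epsilon> in at_right (0::real). 0 < \<epsilon> \<and> (\<forall>k\<in>K. 0 < a k + \<epsilon> * c k)"
    using eventually_at_right_less eventually_conj by blast
  then obtain \<epsilon> where "0 < \<epsilon> \<and> (\<forall>k\<in>K. 0 < a k + \<epsilon> * c k)"
    using eventually_happens trivial_limit_at_right_real by blast
  then show thesis using that by blast
qed

section \<open>Duality between the relaxations\<close>

lemma dual_objective_le_riesz:
  assumes y: "y \<in> primal_feasible g h m L C r" and z: "z \<in> dual_feasible f g h m L r"
  shows "dual_objective C z \<le> riesz r y f"
proof -
  obtain l \<gamma> \<eta> where zd: "z = (l, \<gamma>, \<eta>)" by (cases z) auto
  have l: "\<And>i. i \<in> {1..m} \<Longrightarrow> 0 \<le> l i" and ge: "0 \<le> \<gamma>" "0 \<le> \<eta>"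
    and sos: "f + (\<Sum>i=1..m. l i *\<^sub>R h i) - \<gamma> *\<^sub>R g + \<eta> *\<^sub>R (1 + Theta L r) \<in> sos_upto (2 * r)"
    using z by (auto simp: dual_feasible_def zd PiE_iff)
  have yh: "\<And>i. i \<in> {1..m} \<Longrightarrow> riesz r y (h i) \<le> 0" and yT: "riesz r y (1 + Theta L r) \<le> C"
    and yg: "1 \<le> riesz r y g" and psd: "psd_on (monoms_upto r) (moment_matrix y)"
    using y by (auto simp: primal_feasible_def)
  note lin = linear_add[OF linear_riesz] linear_diff[OF linear_riesz] linear_sum[OF linear_riesz]
    linear_scale[OF linear_riesz]
  have "0 \<le> riesz r y f + (\<Sum>i=1..m. l i * riesz r y (h i)) - \<gamma> * riesz r y g
      + \<eta> * riesz r y (1 + Theta L r)"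
    using riesz_sos_nonneg[OF sos psd] unfolding lin(1)[of _ _ _ "\<eta> *\<^sub>R (1 + Theta L r)"] lin(2-4)
      lin(1)[of _ _ f] by simp
  moreover have "(\<Sum>i=1..m. l i * riesz r y (h i)) \<le> 0"
    using l yh by (intro sum_nonpos mult_nonneg_nonpos) auto
  moreover have "\<gamma> * 1 \<le> \<gamma> * riesz r y g" using ge yg by (intro mult_left_mono)
  moreover have "\<eta> * riesz r y (1 + Theta L r) \<le> \<eta> * C" using ge yT by (intro mult_left_mono)
  ultimately show ?thesis by (simp add: zd dual_objective_def mult.commute)
qed

lemma riesz_bounded_on_primal_feasible:
  assumes L: "0 < L"
  obtains b where "\<And>y. y \<in> primal_feasible g h m L C r \<Longrightarrow> b \<le> riesz r y f"
proof (rule that)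
  fix y assume y: "y \<in> primal_feasible g h m L C r"
  let ?B = "(1 + L ^ (2 * r)) * C"
  have yT: "riesz r y (1 + Theta L r) \<le> C" and psd: "psd_on (monoms_upto r) (moment_matrix y)"
    using y by (auto simp: primal_feasible_def)
  have "\<bar>Poly_Mapping.lookup y \<alpha>\<bar> \<le> ?B" if "\<alpha> \<in> monoms_upto (2 * r)" for \<alpha>
  proof -
    have "(1 + L ^ (2 * r)) * riesz r y (1 + Theta L r) \<le> ?B"
      using yT L by (intro mult_left_mono) auto
    with moment_bound[OF psd L that] show ?thesis by linarith
  qed
  then have "\<bar>riesz r y f\<bar> \<le> (\<Sum>\<alpha>\<in>monoms_upto (2 * r). \<bar>Poly_Mapping.lookup f \<alpha>\<bar> * ?B)"
    unfolding riesz_def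
    by (intro order_trans[OF sum_abs] sum_mono) (simp add: abs_mult mult_left_mono)
  then show "- (\<Sum>\<alpha>\<in>monoms_upto (2 * r). \<bar>Poly_Mapping.lookup f \<alpha>\<bar> * ?B) \<le> riesz r y f"
    by linarith
qed

lemma riesz_zero_moments [simp]: "riesz r 0 p = 0"
  by (simp add: riesz_def)

text \<open>
  The homogenizing variable \<open>t\<close> turns the affine constraints of the moment program into linear ones:
  its points are the pairs \<open>(y, 1)\<close>, and the condition \<open>t \<ge> 0\<close> is the constraint numbered \<open>0\<close>. Reading
  the representation of \<open>L\<^sub>y(f) - v t\<close> at \<open>t = 0\<close> gives the polynomial identity, and at
  \<open>(y, t) = (0, 1)\<close> the inequality \<open>v \<le> \<gamma> - C \<eta>\<close>, whose slack is the multiplier of \<open>t \<ge> 0\<close>.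
\<close>
lemma dual_feasible_attains_lower_bound:
  fixes f g :: "('n::finite) rpoly"
  assumes L: "0 < L"
    and poly: "f \<in> polys_upto (2 * r)" "g \<in> polys_upto (2 * r)"
      "\<And>i. i \<in> {1..m} \<Longrightarrow> h i \<in> polys_upto (2 * r)"
    and e: "0 < e" "\<And>v. e * (\<Sum>\<alpha>\<in>monoms_upto r. (v \<alpha>)\<^sup>2) \<le> quad_form (monoms_upto r) (moment_matrix u) v"
    and u: "\<And>i. i \<in> {1..m} \<Longrightarrow> riesz r u (h i) < 0" "riesz r u (1 + Theta L r) < C" "1 < riesz r u g"
    and v: "\<And>y. y \<in> primal_feasible g h m L C r \<Longrightarrow> v \<le> riesz r y f"
  shows "\<exists>z\<in>dual_feasible f g h m L r. v \<le> dual_objective C z"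
proof -
  let ?I = "monoms_upto r :: 'n monom set"
  let ?K = "insert 0 (insert (m + 1) (insert (m + 2) {1..m}))"
  let ?T = "1 + Theta L r :: 'n rpoly"
  define \<phi> where "\<phi> x = riesz r (fst x) f - v * snd x" for x :: "('n monom \<Rightarrow>\<^sub>0 real) \<times> real"
  define b where "b k = (\<lambda>x. if k = 0 then snd x
      else if k \<le> m then - riesz r (fst x) (h k)
      else if k = m + 1 then riesz r (fst x) g - snd x
      else C * snd x - riesz r (fst x :: 'n monom \<Rightarrow>\<^sub>0 real) ?T)" for k
  have L1: "linear (\<lambda>x. riesz r (fst x) p)" for p :: "'n rpoly"
    using linear_compose[OF linear_fst linear_riesz_moments] by (simp add: o_def)
  have L2: "linear (\<lambda>x. c * snd x)" for c :: real
    by (intro linearI) (auto simp: algebra_simps)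
  have L3: "linear (\<lambda>x. snd x)" by (intro linearI) auto
  have Lp: "linear \<phi>" unfolding \<phi>_def by (intro linear_compose_sub L1 L2)
  have Lb: "linear (b k)" for k
  proof -
    consider "k = 0" | "k \<noteq> 0" "k \<le> m" | "k = m + 1" | "k > m + 1" by linarith
    then show ?thesis
    proof cases
      case 2
      then show ?thesis unfolding b_def by (simp add: linear_compose_neg L1)
    qed (auto simp: b_def intro!: linear_compose_sub L1 L2 L3)
  qed
  have pos: "0 \<le> \<phi> x"
    if psd: "psd_on ?I (moment_matrix (fst x))" and bk: "\<And>k. k \<in> ?K \<Longrightarrow> 0 \<le> b k x" for x
  proof -
    obtain y t where x: "x = (y, t)" by (cases x)
    have t: "0 \<le> t" using bk[of 0] by (simp add: b_def x)
    have yh: "riesz r y (h i) \<le> 0" if "i \<in> {1..m}" for i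
      using bk[of i] that by (simp add: b_def x)
    have yg: "t \<le> riesz r y g" using bk[of "m + 1"] by (simp add: b_def x)
    have yT: "riesz r y ?T \<le> C * t" using bk[of "m + 2"] by (simp add: b_def x)
    have psd: "psd_on ?I (moment_matrix y)" using psd by (simp add: x)
    show ?thesis
    proof (cases "t = 0")
      \<comment> \<open>A recession direction of the feasible set: it has to vanish, since the entries are bounded.\<close>
      case True
      have "Poly_Mapping.lookup y \<alpha> = 0" if "\<alpha> \<in> monoms_upto (2 * r)" for \<alpha>
      proof -
        have "(1 + L ^ (2 * r)) * riesz r y ?T \<le> 0"
          using yT True L by (intro mult_nonneg_nonpos) auto
        with moment_bound[OF psd L that] show ?thesis by linarith
      qed
      then have "riesz r y f = 0" by (simp add: riesz_def)
      then show ?thesis by (simp add: \<phi>_def x True)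
    next
      case False
      with t have t: "0 < t" by simp
      define y' where "y' = mapping_on (monoms_upto (2 * r)) (Poly_Mapping.lookup ((1 / t) *\<^sub>R y))"
      have y': "riesz r y' p = riesz r y p / t" for p
      proof -
        have "riesz r y' p = riesz r ((1 / t) *\<^sub>R y) p"
          by (intro riesz_cong) (simp add: y'_def lookup_mapping_on)
        then show ?thesis by (simp add: linear_scale[OF linear_riesz_moments])
      qed
      have "quad_form ?I (moment_matrix y') w = quad_form ?I (\<lambda>\<alpha> \<beta>. 1 / t * moment_matrix y \<alpha> \<beta>) w" for w
        by (intro quad_form_cong) (auto simp: moment_matrix_def y'_def lookup_mapping_on mem_monoms_upto)
      then have "psd_on ?I (moment_matrix y')"
        using psd t unfolding psd_on_moment_matrix_iff quad_form_scale by simp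
      moreover have "y' \<in> moment_vectors (2 * r)"
        by (simp add: moment_vectors_def y'_def keys_mapping_on)
      ultimately have "y' \<in> primal_feasible g h m L C r"
        using yh yg yT t by (auto simp: primal_feasible_def y' divide_le_0_iff field_simps)
      from v[OF this] show ?thesis using t by (simp add: y' \<phi>_def x field_simps)
    qed
  qed
  have "\<exists>qs \<mu>. (\<forall>k. 0 \<le> \<mu> k) \<and>
    (\<forall>x. \<phi> x = (\<Sum>q\<leftarrow>qs. quad_form ?I (moment_matrix (fst x)) q) + (\<Sum>k\<in>?K. \<mu> k * b k x))"
  proof (rule psd_farkas_with_inequalities[where I = ?I and K = ?K and \<phi> = \<phi> and b = b
        and A = "\<lambda>x. moment_matrix (fst x)" and u = "(u, 1)" and e = e])
    show "linear (\<lambda>x :: ('n monom \<Rightarrow>\<^sub>0 real) \<times> real. moment_matrix (fst x) \<alpha> \<beta>)" for \<alpha> \<beta>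
      by (intro linearI) (auto simp: moment_matrix_add moment_matrix_scaleR)
    show "0 < b k (u, 1)" if "k \<in> ?K" for k
      using that u by (auto simp: b_def)
    show "moment_matrix (fst x) \<alpha> \<beta> = moment_matrix (fst x) \<beta> \<alpha>"
      for x :: "('n monom \<Rightarrow>\<^sub>0 real) \<times> real" and \<alpha> \<beta>
      by (rule moment_matrix_commute)
    show "e * (\<Sum>\<alpha>\<in>?I. (w \<alpha>)\<^sup>2) \<le> quad_form ?I (moment_matrix (fst (u, 1 :: real))) w" for w
      using e(2) by simp
  qed (simp_all only: Lp Lb pos e(1) finite_monoms_upto finite_insert finite_atLeastAtMost)
  then obtain qs \<mu> where \<mu>: "\<And>k. 0 \<le> \<mu> k"
    and rep: "\<And>x. \<phi> x = (\<Sum>q\<leftarrow>qs. quad_form ?I (moment_matrix (fst x)) q) + (\<Sum>k\<in>?K. \<mu> k * b k x)"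
    by blast
  define P where "P q = mapping_on ?I q" for q
  have P: "P q \<in> polys_upto r" for q
    by (simp add: polys_upto_def P_def keys_mapping_on)
  have Psq: "quad_form ?I (moment_matrix y) q = riesz r y (P q ^ 2)" for y q
    unfolding riesz_square[OF P] by (intro quad_form_cong) (auto simp: P_def lookup_mapping_on)
  let ?\<gamma> = "\<mu> (m + 1)" and ?\<eta> = "\<mu> (m + 2)"
  have ids: "riesz r y f - v * t = (\<Sum>q\<leftarrow>qs. riesz r y (P q ^ 2)) + (\<mu> 0 * t
      + ?\<gamma> * (riesz r y g - t) + ?\<eta> * (C * t - riesz r y ?T) - (\<Sum>i=1..m. \<mu> i * riesz r y (h i)))" for y t
  proof -
    have "(\<Sum>i=1..m. \<mu> i * b i (y, t)) = - (\<Sum>i=1..m. \<mu> i * riesz r y (h i))"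
      unfolding sum_negf[symmetric] by (intro sum.cong) (auto simp: b_def)
    then show ?thesis
      using rep[of "(y, t)"] by (simp add: \<phi>_def Psq b_def)
  qed
  define l where "l = restrict \<mu> {1..m}"
  let ?F = "f + (\<Sum>i=1..m. l i *\<^sub>R h i) - ?\<gamma> *\<^sub>R g + ?\<eta> *\<^sub>R ?T"
  have F: "?F \<in> polys_upto (2 * r)"
    by (intro polys_upto_add polys_upto_diff polys_upto_scaleR polys_upto_sum poly
        one_plus_Theta_in_polys_upto)
  have "?F = (\<Sum>q\<leftarrow>map P qs. q ^ 2)"
  proof (rule poly_eq_if_riesz_eq)
    show "?F \<in> polys_upto (2 * r)" by (rule F)
    show "(\<Sum>q\<leftarrow>map P qs. q ^ 2) \<in> polys_upto (2 * r)"
      using P by (auto intro!: polys_upto_sum_list polys_upto_square)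
    fix y
    note lin = linear_add[OF linear_riesz] linear_diff[OF linear_riesz] linear_sum[OF linear_riesz]
      linear_scale[OF linear_riesz]
    have "riesz r y ?F = riesz r y f + (\<Sum>i=1..m. \<mu> i * riesz r y (h i)) - ?\<gamma> * riesz r y g + ?\<eta> * riesz r y ?T"
      unfolding lin(1)[of _ _ _ "?\<eta> *\<^sub>R ?T"] lin(2-4) lin(1)[of _ _ f] by (simp add: l_def)
    also have "\<dots> = (\<Sum>q\<leftarrow>qs. riesz r y (P q ^ 2))"
      using ids[of y 0] by simp
    also have "\<dots> = riesz r y (\<Sum>q\<leftarrow>map P qs. q ^ 2)"
      by (induction qs) (simp_all add: linear_0[OF linear_riesz] lin(1))
    finally show "riesz r y ?F = riesz r y (\<Sum>q\<leftarrow>map P qs. q ^ 2)" .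
  qed
  with F have "?F \<in> sos_upto (2 * r)" unfolding sos_upto_def by blast
  then have "(l, ?\<gamma>, ?\<eta>) \<in> dual_feasible f g h m L r"
    using \<mu> by (auto simp: dual_feasible_def l_def)
  moreover have "v \<le> dual_objective C (l, ?\<gamma>, ?\<eta>)"
  proof -
    have "(\<Sum>q\<leftarrow>qs. (0::real)) = 0" by (induction qs) auto
    then have "- v = \<mu> 0 - ?\<gamma> + ?\<eta> * C" using ids[of 0 1] by simp
    then show ?thesis using \<mu>[of 0] by (simp add: dual_objective_def mult.commute)
  qed
  ultimately show ?thesis by blast
qed

lemma strictly_feasible_moments:
  fixes x :: "real ^ 'n" and h :: "nat \<Rightarrow> 'n rpoly" and m r :: nat
  assumes r: "1 \<le> r" and L: "0 < L" "norm x \<le> L"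
    and poly: "g \<in> polys_upto (2 * r)" "\<And>i. i \<in> {1..m} \<Longrightarrow> h i \<in> polys_upto (2 * r)"
    and h: "\<And>i. i \<in> {1..m} \<Longrightarrow> poly_eval (h i) x < 0"
    and g: "0 < poly_eval g x" and C: "2 / poly_eval g x < C"
  shows "\<exists>u e. 0 < e \<and>
    (\<forall>v. e * (\<Sum>\<alpha>\<in>monoms_upto r. (v \<alpha>)\<^sup>2) \<le> quad_form (monoms_upto r) (moment_matrix u) v) \<and>
    (\<forall>i\<in>{1..m}. riesz r u (h i) < 0) \<and> riesz r u (1 + Theta L r) < C \<and> 1 < riesz r u g"
proof -
  \<comment> \<open>Any mass strictly between \<open>1 / g(x)\<close> and \<open>C / 2\<close> makes both normalizations strict.\<close>
  define t where "t = (1 / poly_eval g x + C / 2) / 2"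
  have "1 / poly_eval g x < C / 2" using C by (simp add: field_simps)
  then have t: "1 / poly_eval g x < t" "2 * t < C" by (auto simp: t_def field_simps)
  have t0: "0 < t" using t(1) g by (meson divide_pos_pos less_trans zero_less_one)
  have tg: "1 < t * poly_eval g x" using t(1) g by (simp add: field_simps)
  let ?p = "point_moments r x"
  define w :: "'n monom \<Rightarrow>\<^sub>0 real" where "w = lognormal_moments r (2 * real (card (monoms_upto r :: 'n monom set)))"
  have wpos: "1 / 2 * (\<Sum>\<alpha>\<in>monoms_upto r. (v \<alpha>)\<^sup>2) \<le> quad_form (monoms_upto r) (moment_matrix w) v" for v
    unfolding w_def by (rule lognormal_moment_matrix_pos)
  define a where "a k = (if k = 0 then C - t * riesz r ?p (1 + Theta L r) else if k \<le> m then - t * poly_eval (h k) x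
    else t * poly_eval g x - 1)" for k
  define c where "c k = (if k = 0 then - riesz r w (1 + Theta L r) else if k \<le> m then - riesz r w (h k)
    else riesz r w g)" for k
  have "0 < a k" if "k \<in> {0..m + 1}" for k
  proof -
    have "t * riesz r ?p (1 + Theta L r) \<le> t * 2"
      using point_moments_Theta_le[OF r L(2,1)] t0 by (intro mult_left_mono) auto
    then have le: "t * riesz r ?p (1 + Theta L r) < C" using t by linarith
    consider "k = 0" | "k \<in> {1..m}" | "k = m + 1" using \<open>k \<in> {0..m + 1}\<close> by fastforce
    then show ?thesis
    proof cases
      case 2
      then have "t * poly_eval (h k) x < 0" using h t0 by (intro mult_pos_neg) auto
      with 2 show ?thesis by (simp add: a_def)
    qed (use le tg in \<open>auto simp: a_def\<close>)
  qed
  then obtain \<epsilon> where eps: "0 < \<epsilon>" "\<And>k. k \<in> {0..m + 1} \<Longrightarrow> 0 < a k + \<epsilon> * c k"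
    using strict_inequalities_perturb[of "{0..m + 1}" a c] finite_atLeastAtMost by blast
  define u where "u = t *\<^sub>R ?p + \<epsilon> *\<^sub>R w"
  have ru: "riesz r u p = t * riesz r ?p p + \<epsilon> * riesz r w p" for p
    by (simp add: u_def linear_add[OF linear_riesz_moments] linear_scale[OF linear_riesz_moments])
  show ?thesis
  proof (intro exI[of _ u] exI[of _ "\<epsilon> / 2"] conjI allI ballI)
    show "0 < \<epsilon> / 2" using eps by simp
    fix v
    have "quad_form (monoms_upto r) (moment_matrix u) v =
        t * quad_form (monoms_upto r) (moment_matrix ?p) v + \<epsilon> * quad_form (monoms_upto r) (moment_matrix w) v"
      unfolding quad_form_scale[symmetric] quad_form_add[symmetric]
      by (intro quad_form_cong) (simp_all add: u_def moment_matrix_add moment_matrix_scaleR)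
    moreover have "0 \<le> t * quad_form (monoms_upto r) (moment_matrix ?p) v"
      using t0 by (simp add: quad_form_point_moments)
    moreover have "\<epsilon> * (1 / 2 * (\<Sum>\<alpha>\<in>monoms_upto r. (v \<alpha>)\<^sup>2)) \<le> \<epsilon> * quad_form (monoms_upto r) (moment_matrix w) v"
      using eps(1) wpos by (intro mult_left_mono) auto
    ultimately show "\<epsilon> / 2 * (\<Sum>\<alpha>\<in>monoms_upto r. (v \<alpha>)\<^sup>2) \<le> quad_form (monoms_upto r) (moment_matrix u) v"
      by simp
  next
    fix i assume i: "i \<in> {1..m}"
    then show "riesz r u (h i) < 0"
      using eps(2)[of i] by (simp add: ru riesz_point_moments[OF poly(2)[OF i]] a_def c_def)
  next
    show "riesz r u (1 + Theta L r) < C" using eps(2)[of 0] by (simp add: ru a_def c_def)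
    show "1 < riesz r u g"
      using eps(2)[of "m + 1"] by (simp add: ru riesz_point_moments[OF poly(1)] a_def c_def)
  qed
qed

lemma scaled_point_moments_primal_feasible:
  assumes r: "1 \<le> r" and L: "0 < L" "norm x \<le> L"
    and poly: "g \<in> polys_upto (2 * r)" "\<And>i. i \<in> {1..m} \<Longrightarrow> h i \<in> polys_upto (2 * r)"
    and x: "x \<in> feasible_set h m" and g: "0 < poly_eval g x" and C: "2 / poly_eval g x \<le> C"
  shows "(1 / poly_eval g x) *\<^sub>R point_moments r x \<in> primal_feasible g h m L C r"
proof -
  let ?t = "1 / poly_eval g x" and ?p = "point_moments r x"
  have ru: "riesz r (?t *\<^sub>R ?p) p = ?t * riesz r ?p p" for p
    by (rule linear_scale[OF linear_riesz_moments, simplified])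
  have "quad_form (monoms_upto r) (moment_matrix (?t *\<^sub>R ?p)) v =
      quad_form (monoms_upto r) (\<lambda>\<alpha> \<beta>. ?t * moment_matrix ?p \<alpha> \<beta>) v" for v
    by (intro quad_form_cong) (simp_all add: moment_matrix_scaleR)
  then have "psd_on (monoms_upto r) (moment_matrix (?t *\<^sub>R ?p))"
    unfolding psd_on_moment_matrix_iff quad_form_scale quad_form_point_moments using g by simp
  moreover have "?t *\<^sub>R ?p \<in> moment_vectors (2 * r)"
    by (auto simp: moment_vectors_def in_keys_iff point_moments_def lookup_mapping_on split: if_splits)
  moreover have "riesz r (?t *\<^sub>R ?p) (h i) \<le> 0" if "i \<in> {1..m}" for i
    using x that g unfolding ru riesz_point_moments[OF poly(2)[OF that]]
    by (auto simp: feasible_set_def divide_le_0_iff)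
  moreover have "riesz r (?t *\<^sub>R ?p) (1 + Theta L r) \<le> C"
  proof -
    have "?t * riesz r ?p (1 + Theta L r) \<le> ?t * 2"
      using point_moments_Theta_le[OF r L(2,1)] g by (intro mult_left_mono) auto
    with C show ?thesis unfolding ru by simp
  qed
  moreover have "riesz r (?t *\<^sub>R ?p) g = 1"
    unfolding ru riesz_point_moments[OF poly(1)] using g by simp
  ultimately show ?thesis by (simp add: primal_feasible_def)
qed

section \<open>Moment matrices of rank one\<close>

lemma rank_one_minor:
  assumes I: "finite I" and rank: "rank_on I J M = 1"
    and ij: "i \<in> I" "k \<in> I" "j \<in> J" "l \<in> J"
  shows "M i j * M k l = M i l * M k j"
proof -
  obtain B where B: "matrix_column I M ` J \<subseteq> span B" "card B = 1"
    using basis_exists[of "matrix_column I M ` J"] rank unfolding rank_on_def by metis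
  then obtain w where w: "B = {w}" by (meson card_1_singletonE)
  have "\<exists>c. \<forall>i\<in>I. M i j = c * Poly_Mapping.lookup w i" if "j \<in> J" for j
  proof -
    have "matrix_column I M j \<in> span {w}" using B(1) that w by blast
    then obtain c where c: "matrix_column I M j = c *\<^sub>R w" by (auto simp: span_singleton)
    have "Poly_Mapping.lookup (matrix_column I M j) i = M i j" if "i \<in> I" for i
      using that I by (simp add: matrix_column_def lookup_sum lookup_single when_def)
    then show ?thesis unfolding c lookup_scaleR by metis
  qed
  then obtain c where "\<And>i j. i \<in> I \<Longrightarrow> j \<in> J \<Longrightarrow> M i j = c j * Poly_Mapping.lookup w i"
    by metis
  with ij show ?thesis by simp
qed

text \<open>
  The vanishing minors \<open>y\<^sub>\<alpha>\<^sub>+\<^sub>\<beta> y\<^sub>0 = y\<^sub>\<alpha> y\<^sub>\<beta>\<close> make \<open>y / y\<^sub>0\<close> multiplicative on monomials of degree at most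
  \<open>r\<close>. Its values there are products of its values at single variables, and a monomial of degree at
  most \<open>2 r\<close> is a product of two such monomials.
\<close>
lemma rank_one_moments_are_point_moments:
  fixes y :: "('n::finite) monom \<Rightarrow>\<^sub>0 real"
  assumes r: "1 \<le> r" and y0: "Poly_Mapping.lookup y 0 \<noteq> 0"
    and rank: "rank_on (monoms_upto r) (monoms_upto r) (moment_matrix y) = 1"
    and a: "\<alpha> \<in> monoms_upto (2 * r)"
  defines "x \<equiv> (1 / Poly_Mapping.lookup y 0) *\<^sub>R (\<chi> i. riesz r y (pvar i))"
  shows "Poly_Mapping.lookup y \<alpha> = Poly_Mapping.lookup y 0 * monom_val x \<alpha>"
proof -
  define z where "z \<alpha> = Poly_Mapping.lookup y \<alpha> / Poly_Mapping.lookup y 0" for \<alpha>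
  have mult: "z (\<alpha> + \<beta>) = z \<alpha> * z \<beta>" if "\<alpha> \<in> monoms_upto r" "\<beta> \<in> monoms_upto r" for \<alpha> \<beta>
    using rank_one_minor[OF finite_monoms_upto rank, of \<alpha> 0 \<beta> 0] that y0
    by (simp add: mem_monoms_upto moment_matrix_def z_def field_simps)
  have xi: "x $ i = z (Poly_Mapping.single i 1)" for i
    using riesz_pvar[OF r, of y i] by (simp add: x_def z_def)
  have small: "z \<alpha> = monom_val x \<alpha>" if "monom_deg \<alpha> = k" "k \<le> r" for \<alpha> k
    using that
  proof (induction k arbitrary: \<alpha>)
    case 0
    then have "\<alpha> = 0" using lookup_le_monom_deg[of \<alpha>] by (intro poly_mapping_eqI) simp
    then show ?case using y0 by (simp add: z_def)
  next
    case (Suc k)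
    then have "monom_deg \<alpha> \<noteq> 0" by simp
    then obtain i \<gamma> where s: "\<alpha> = Poly_Mapping.single i 1 + \<gamma>" using monom_split_variable by blast
    then have g: "monom_deg \<gamma> = k" using Suc.prems by simp
    let ?\<beta> = "Poly_Mapping.single i 1 :: 'n monom"
    have "z \<alpha> = z ?\<beta> * z \<gamma>" unfolding s using g r Suc.prems by (intro mult) (auto simp: mem_monoms_upto)
    also have "\<dots> = monom_val x ?\<beta> * monom_val x \<gamma>"
      using Suc.IH[OF g] Suc.prems xi by simp
    finally show ?case unfolding s by (simp add: monom_val_add)
  qed
  obtain \<beta> \<gamma> where s: "\<alpha> = \<beta> + \<gamma>" "\<beta> \<in> monoms_upto r" "\<gamma> \<in> monoms_upto r"
    using monom_halve[OF a] .
  then have "z \<alpha> = monom_val x \<alpha>"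
    using mult[of \<beta> \<gamma>] small[of \<beta>] small[of \<gamma>] by (simp add: mem_monoms_upto monom_val_add)
  then show ?thesis using y0 by (simp add: z_def field_simps)
qed

lemma rank_one_riesz:
  fixes y :: "('n::finite) monom \<Rightarrow>\<^sub>0 real"
  assumes "1 \<le> r" "Poly_Mapping.lookup y 0 \<noteq> 0"
    and "rank_on (monoms_upto r) (monoms_upto r) (moment_matrix y) = 1"
    and p: "p \<in> polys_upto (2 * r)"
  shows "riesz r y p = Poly_Mapping.lookup y 0 *
    poly_eval p ((1 / Poly_Mapping.lookup y 0) *\<^sub>R (\<chi> i. riesz r y (pvar i)))"
proof -
  define x where "x = (1 / Poly_Mapping.lookup y 0) *\<^sub>R (\<chi> i. riesz r y (pvar i))"
  have "Poly_Mapping.lookup y \<alpha> = Poly_Mapping.lookup y 0 * monom_val x \<alpha>"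
    if "\<alpha> \<in> monoms_upto (2 * r)" for \<alpha>
    unfolding x_def by (rule rank_one_moments_are_point_moments[OF assms(1-3) that])
  then have "riesz r y p = Poly_Mapping.lookup y 0 * poly_eval p x"
    unfolding riesz_def poly_eval_eq_sum[OF p] sum_distrib_left by (intro sum.cong) auto
  then show ?thesis unfolding x_def .
qed

section \<open>The fractional program and its relaxations\<close>

text \<open>
  Constant constraints cut out either nothing or the whole space.
\<close>
lemma degree_bound_pos_if_bounded:
  fixes h :: "nat \<Rightarrow> ('n::finite) rpoly"
  assumes h: "\<forall>i\<in>{1..m}. h i \<in> polys_upto (2 * d)"
    and K: "feasible_set h m \<noteq> {}" "bounded (feasible_set h m)"
  shows "1 \<le> d"
proof (rule ccontr)
  assume "\<not> 1 \<le> d"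
  then have d: "d = 0" by simp
  have m0: "(monoms_upto 0 :: 'n monom set) = {0}"
  proof -
    have "\<alpha> = 0" if "monom_deg \<alpha> = 0" for \<alpha> :: "'n monom"
      using that lookup_le_monom_deg[of \<alpha>] by (intro poly_mapping_eqI) simp
    then show ?thesis by (auto simp: mem_monoms_upto)
  qed
  have const: "poly_eval (h i) x = poly_eval (h i) x'" if "i \<in> {1..m}" for i x x'
    using h that poly_eval_eq_sum[of "h i" 0] by (simp add: d m0)
  obtain x where x: "x \<in> feasible_set h m" using K(1) by blast
  have "x' \<in> feasible_set h m" for x'
    using x const[of _ x' x] by (simp add: feasible_set_def)
  then have "feasible_set h m = UNIV" by blast
  with K(2) show False by simp
qed

lemma closed_feasible_set: "closed (feasible_set h m)"
proof -
  have "feasible_set h m = (\<Inter>i\<in>{1..m}. {x. poly_eval (h i) x \<le> 0})"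
    by (auto simp: feasible_set_def)
  also have "closed \<dots>"
    by (intro closed_INT ballI closed_Collect_le continuous_on_poly_eval continuous_on_const)
  finally show ?thesis .
qed

theorem theorem4p4:
  fixes f g :: "('n::finite) rpoly" and h :: "nat \<Rightarrow> 'n rpoly"
    and m d r :: nat and L C :: real
  defines "K \<equiv> feasible_set h m"
  assumes "f \<in> polys_upto (2 * d)" and "g \<in> polys_upto (2 * d)"
    and "\<forall>i\<in>{1..m}. h i \<in> polys_upto (2 * d)"
    and "convex_on UNIV (poly_eval f)" and "convex_on UNIV (poly_eval (- g))"
    and "\<forall>i\<in>{1..m}. convex_on UNIV (poly_eval (h i))"
    and "K \<noteq> {}" and "bounded K"
    and "\<forall>x\<in>K. 0 \<le> poly_eval f x" and "\<forall>x\<in>K. 0 < poly_eval g x"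
    and "(SUP x\<in>K. norm x) < L" and "2 / (INF x\<in>K. poly_eval g x) < C"
    and "d \<le> r"
  shows
    "((\<exists>x. \<forall>i\<in>{1..m}. poly_eval (h i) x < 0) \<longrightarrow>
        (SUP z\<in>dual_feasible f g h m L r. ereal (dual_objective C z)) =
          (INF y\<in>primal_feasible g h m L C r. ereal (riesz r y f)) \<and>
        (\<exists>z. is_arg_max (dual_objective C) (\<lambda>z. z \<in> dual_feasible f g h m L r) z))
     \<and>
     (\<forall>y. is_arg_min (\<lambda>y. riesz r y f) (\<lambda>y. y \<in> primal_feasible g h m L C r) y \<longrightarrow>
        Poly_Mapping.lookup y 0 \<noteq> 0 \<longrightarrow>
        rank_on (monoms_upto r) (monoms_upto r) (moment_matrix y) = 1 \<longrightarrow>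
        is_arg_min (\<lambda>x. poly_eval f x / poly_eval g x) (\<lambda>x. x \<in> K)
          ((1 / Poly_Mapping.lookup y 0) *\<^sub>R (\<chi> i. riesz r y (pvar i))))"
proof -
  note f = assms(2) and g = assms(3) and h = assms(4) and Kne = assms(8) and Kb = assms(9)
    and fpos = assms(10) and gpos = assms(11) and LK = assms(12) and CK = assms(13) and dr = assms(14)
  have r: "1 \<le> r"
    using degree_bound_pos_if_bounded[OF h] Kne Kb dr unfolding K_def by linarith
  have up: "p \<in> polys_upto (2 * r)" if "p \<in> polys_upto (2 * d)" for p :: "'n rpoly"
    by (rule polys_upto_mono[OF that]) (use dr in simp)
  have poly: "f \<in> polys_upto (2 * r)" "g \<in> polys_upto (2 * r)"
    "\<And>i. i \<in> {1..m} \<Longrightarrow> h i \<in> polys_upto (2 * r)"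
    using f g h by (blast intro: up)+
  have "bdd_above (norm ` K)" using Kb by (auto simp: bounded_iff bdd_above_def)
  then have normL: "norm x \<le> L" if "x \<in> K" for x
    using cSUP_upper[OF that] LK by (meson le_less_trans less_imp_le)
  have "compact K"
    using Kb closed_feasible_set unfolding K_def by (simp add: compact_eq_bounded_closed)
  obtain x0 where x0: "x0 \<in> K" "\<And>x. x \<in> K \<Longrightarrow> poly_eval g x0 \<le> poly_eval g x"
    using continuous_attains_inf[OF \<open>compact K\<close> Kne continuous_on_poly_eval] by blast
  have "(INF x\<in>K. poly_eval g x) = poly_eval g x0"
    using x0 by (intro cInf_eq_minimum) auto
  with CK have C0: "2 / poly_eval g x0 < C" by simp
  have C: "2 / poly_eval g x < C" if "x \<in> K" for x
  proof -
    have "2 / poly_eval g x \<le> 2 / poly_eval g x0"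
      using gpos x0 that by (intro divide_left_mono) auto
    with C0 show ?thesis by linarith
  qed
  have L: "0 < L"
  proof -
    have "norm x0 \<le> (SUP x\<in>K. norm x)" using \<open>bdd_above (norm ` K)\<close> x0(1) by (rule cSUP_upper2) simp
    with LK norm_ge_zero[of x0] show ?thesis by linarith
  qed
  have feas: "(1 / poly_eval g x) *\<^sub>R point_moments r x \<in> primal_feasible g h m L C r" if "x \<in> K" for x
    using that gpos C[OF that] normL[OF that] poly r L unfolding K_def
    by (intro scaled_point_moments_primal_feasible) auto
  let ?P = "primal_feasible g h m L C r" and ?D = "dual_feasible f g h m L r"
  have part1: "(SUP z\<in>?D. ereal (dual_objective C z)) = (INF y\<in>?P. ereal (riesz r y f)) \<and>
      (\<exists>z. is_arg_max (dual_objective C) (\<lambda>z. z \<in> ?D) z)"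
    if slater: "\<exists>x. \<forall>i\<in>{1..m}. poly_eval (h i) x < 0"
  proof -
    obtain x where x: "\<And>i. i \<in> {1..m} \<Longrightarrow> poly_eval (h i) x < 0" using slater by blast
    then have xK: "x \<in> K" by (force simp: K_def feasible_set_def)
    have gx: "0 < poly_eval g x" using gpos xK by blast
    obtain u e where u: "0 < e"
      "\<forall>v. e * (\<Sum>\<alpha>\<in>monoms_upto r. (v \<alpha>)\<^sup>2) \<le> quad_form (monoms_upto r) (moment_matrix u) v"
      "\<forall>i\<in>{1..m}. riesz r u (h i) < 0" "riesz r u (1 + Theta L r) < C" "1 < riesz r u g"
      using strictly_feasible_moments[where h = h and m = m, OF r L normL[OF xK] poly(2,3) x gx C[OF xK]] by blast
    obtain b where b: "\<And>y. y \<in> ?P \<Longrightarrow> b \<le> riesz r y f"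
      using riesz_bounded_on_primal_feasible[OF L] by metis
    define v where "v = (INF y\<in>?P. riesz r y f)"
    have ne: "?P \<noteq> {}" using feas[OF xK] by blast
    have v: "v \<le> riesz r y f" if "y \<in> ?P" for y
      unfolding v_def using b that by (intro cINF_lower bdd_belowI2) auto
    obtain z where z: "z \<in> ?D" "v \<le> dual_objective C z"
      using dual_feasible_attains_lower_bound[where h = h and m = m, OF L poly u(1) u(2,3)[rule_format] u(4,5) v] by blast
    have le_v: "dual_objective C z' \<le> v" if "z' \<in> ?D" for z'
      unfolding v_def using dual_objective_le_riesz[OF _ that] ne by (intro cINF_greatest) auto
    have "(INF y\<in>?P. ereal (riesz r y f)) = ereal v"
      using ereal_Inf'[of "(\<lambda>y. riesz r y f) ` ?P"] b ne unfolding v_def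
      by (force simp: image_image bdd_below_def)
    moreover have "(SUP z\<in>?D. ereal (dual_objective C z)) = ereal v"
      using z le_v by (intro antisym SUP_least SUP_upper2[of z]) auto
    moreover have "is_arg_max (dual_objective C) (\<lambda>z. z \<in> ?D) z"
      using z le_v by (force simp: is_arg_max_linorder)
    ultimately show ?thesis by metis
  qed
  have part2: "is_arg_min (\<lambda>x. poly_eval f x / poly_eval g x) (\<lambda>x. x \<in> K)
      ((1 / Poly_Mapping.lookup y 0) *\<^sub>R (\<chi> i. riesz r y (pvar i)))"
    if opt: "is_arg_min (\<lambda>y. riesz r y f) (\<lambda>y. y \<in> ?P) y"
      and y0: "Poly_Mapping.lookup y 0 \<noteq> 0"
      and rank: "rank_on (monoms_upto r) (monoms_upto r) (moment_matrix y) = 1" for y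
  proof -
    let ?x = "(1 / Poly_Mapping.lookup y 0) *\<^sub>R (\<chi> i. riesz r y (pvar i))"
    let ?c = "Poly_Mapping.lookup y 0"
    note ev = rank_one_riesz[OF r y0 rank]
    have y: "y \<in> ?P" and min: "\<And>y'. y' \<in> ?P \<Longrightarrow> riesz r y f \<le> riesz r y' f"
      using opt by (auto simp: is_arg_min_linorder)
    have psd: "psd_on (monoms_upto r) (moment_matrix y)" using y by (simp add: primal_feasible_def)
    have c: "0 < ?c"
      using moment_offdiagonal_bound[OF psd, of 0 0] y0 by (simp add: mem_monoms_upto)
    have xK: "?x \<in> K"
      using y c by (auto simp: K_def feasible_set_def primal_feasible_def ev[OF poly(3)] mult_le_0_iff)
    have g1: "1 \<le> ?c * poly_eval g ?x" using y by (simp add: primal_feasible_def ev[OF poly(2)])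
    have gx: "0 < poly_eval g ?x" using gpos xK by blast
    have "poly_eval f ?x / poly_eval g ?x \<le> poly_eval f x / poly_eval g x" if x: "x \<in> K" for x
    proof -
      have "1 * poly_eval f ?x \<le> ?c * poly_eval g ?x * poly_eval f ?x"
        using g1 fpos xK by (intro mult_right_mono) auto
      then have "poly_eval f ?x / poly_eval g ?x \<le> ?c * poly_eval f ?x"
        using gx by (simp add: field_simps)
      also have "\<dots> = riesz r y f" by (simp add: ev[OF poly(1)])
      also have "\<dots> \<le> riesz r ((1 / poly_eval g x) *\<^sub>R point_moments r x) f"
        by (rule min[OF feas[OF x]])
      also have "\<dots> = poly_eval f x / poly_eval g x"
        by (simp add: linear_scale[OF linear_riesz_moments] riesz_point_moments[OF poly(1)])
      finally show ?thesis .
    qed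
    with xK show ?thesis by (simp add: is_arg_min_linorder)
  qed
  show ?thesis using part1 part2 by blast
qed

end
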